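(* Let $s\ge 2$ be an integer and $b=\sqrt{s}$. There exist positive constants $c_1$, $c_2$ and $\beta_0$ (depending on $s$) such that for every $\beta\le\beta_0$, $$\exp\left(-\frac{c_1}{\beta^2}\right)\le h_c(\beta)\le \exp\left(-\frac{c_2}{\beta}\right).$$
   Context: Hierarchical pinning model with site disorder. Fix an integer $s\ge 2$ and a real $b>1$. Let $\omega_1$ be a real random variable (law $\mathbb P$, expectation $\mathbb E$) with $\mathbb E[\omega_1]=0$, $\mathbb E[\omega_1^2]=1$ and $M(\beta):=\mathbb E[e^{\beta\omega_1}]<\infty$ for every $\beta>0$. For $\beta>0$, $h\in\mathbb R$, let $A$ denote a random variable with the law of $\exp(\beta\omega_1-\log M(\beta)+h)$. Define random variables $R_n=R_n(\beta,h)$ (in law) recursively by $R_0:=1$ and $$R_{n+1}=\frac{\prod_{j=1}^{s}R_n^{(j)}\prod_{j=1}^{s-1}A_j+b-1}{b},$$ where $R_n^{(1)},\dots,R_n^{(s)},A_1,\dots,A_{s-1}$ are independent, each $R_n^{(j)}$ has the law of $R_n$ and each $A_j$ has the law of $A$. The free energy is $\textsc{f}(\beta,h):=\lim_{n\to\infty}s^{-n}\mathbb E\log R_n$ (this limit exists, is also the almost sure limit of $s^{-n}\log R_n$, and is non-negative and non-decreasing in $h$). The critical point is $h_c(\beta):=\inf\{h:\textsc{f}(\beta,h)>0\}$. *)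

theory Defs
  imports "HOL-Probability.Probability"
begin

definition omega_law :: "real measure \<Rightarrow> bool" where
  "omega_law \<mu> \<longleftrightarrow> prob_space \<mu> \<and> sets \<mu> = sets borel
     \<and> integrable \<mu> (\<lambda>x. x) \<and> (\<integral>x. x \<partial>\<mu>) = 0
     \<and> integrable \<mu> (\<lambda>x. x\<^sup>2) \<and> (\<integral>x. x\<^sup>2 \<partial>\<mu>) = 1
     \<and> (\<forall>\<beta>>0. integrable \<mu> (\<lambda>x. exp (\<beta> * x)))"

definition mgf :: "real measure \<Rightarrow> real \<Rightarrow> real" where
  "mgf \<mu> \<beta> = (\<integral>x. exp (\<beta> * x) \<partial>\<mu>)"

definition A_law :: "real measure \<Rightarrow> real \<Rightarrow> real \<Rightarrow> real measure" where
  "A_law \<mu> \<beta> h = distr \<mu> borel (\<lambda>w. exp (\<beta> * w - ln (mgf \<mu> \<beta>) + h))"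

primrec R_law :: "nat \<Rightarrow> real \<Rightarrow> real measure \<Rightarrow> real \<Rightarrow> real \<Rightarrow> nat \<Rightarrow> real measure" where
  "R_law s b \<mu> \<beta> h 0 = return borel 1"
| "R_law s b \<mu> \<beta> h (Suc n) =
     distr ((PiM {..<s} (\<lambda>_. R_law s b \<mu> \<beta> h n)) \<Otimes>\<^sub>M (PiM {..<s - 1} (\<lambda>_. A_law \<mu> \<beta> h)))
       borel
       (\<lambda>(r, a). ((\<Prod>j<s. r j) * (\<Prod>j<s - 1. a j) + b - 1) / b)"

definition free_energy :: "nat \<Rightarrow> real \<Rightarrow> real measure \<Rightarrow> real \<Rightarrow> real \<Rightarrow> real" where
  "free_energy s b \<mu> \<beta> h = lim (\<lambda>n. (\<integral>x. ln x \<partial>(R_law s b \<mu> \<beta> h n)) / real s ^ n)"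

definition h_crit :: "nat \<Rightarrow> real \<Rightarrow> real measure \<Rightarrow> real \<Rightarrow> real" where
  "h_crit s b \<mu> \<beta> = Inf {h. free_energy s b \<mu> \<beta> h > 0}"

end

theory Submission
  imports Defs
begin

text \<open>
  At \<open>b = sqrt s\<close> the annealed recursion \<open>r \<mapsto> (r^s exp ((s - 1) h) + b - 1) / b\<close> has the unstable
  fixed point \<open>1\<close> with multiplier \<open>s / b = b\<close> when \<open>h = 0\<close>, while relative variances are, to first
  order, multiplied by \<open>s / b\<^sup>2 = 1\<close> and increased by a term of order \<open>\<beta>\<^sup>2\<close>.

  Upper bound: if \<open>h = exp (- c2 / \<beta>)\<close>, the annealed mean reaches a large constant after about
  \<open>c2 / (\<beta> ln b)\<close> steps, and until then the relative variance stays below \<open>\<beta>\<close>. So \<open>R_n\<close> is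
  large with high probability, and \<open>E ln R_n\<close> exceeds the threshold above which superadditivity
  makes the free energy positive.

  Lower bound: the disorder variables created at step \<open>k\<close> are tilted by an amount proportional to
  \<open>b\<^bsup>-(n - k)\<^esup>\<close>, their probability of being visited (up to constants), over \<open>n\<close> of order \<open>1 / \<beta>\<^sup>2\<close>
  steps. The total cost of the tilt is small, but each of the \<open>n\<close> scales contributes equally to
  lowering the tilted mean of \<open>R_n\<close>, which drops below \<open>1\<close> by a constant. Hence a fractional moment
  of \<open>R_n\<close> is below the unstable fixed point of its own recursion and stays bounded, and the
  free energy vanishes.
\<close>

section \<open>Products of independent positive variables\<close>

text \<open>The exponents \<open>1 / \<beta>\<close> and \<open>1 / \<beta>\<^sup>2\<close> reflect
  how many steps \<open>n\<close> are affordable or required: growth by \<open>b\<close> over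
  \<open>n\<close> steps makes an \<open>h\<close> of order \<open>b\<close> to the power
  \<open>-n\<close> visible. While the annealed mean is near 1, the relative variance obeys
  \<open>w' = w + O(w\<^sup>2 + \<beta>\<^sup>2)\<close>, a Riccati-type recursion under control
  only for \<open>n\<close> of order \<open>1 / \<beta>\<close>. The cost of the tilt is of order
  \<open>1 / (n \<beta>\<^sup>2)\<close>, so \<open>n\<close> of order
  \<open>1 / \<beta>\<^sup>2\<close> is required for it to lose against a constant gain.
  \<open>R_n\<close> is given only in law, so no tree of disorder variables is built, nor a tilted
  measure on it. Independent products are multiplicative convolutions, and the change of measure is
  made on one \<open>A\<close> at a time, then carried through the recursion as a pair (cost, tilted
  mean) that bounds fractional moments. A first moment cannot suffice, the untilted mean being at
  least 1 for \<open>h \<ge> 0\<close>; and \<theta> must be close to 1 so that a barrier for the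
  \<theta>-th moment can be placed at a given level just below 1.\<close>

definition mult_conv :: "real measure \<Rightarrow> real measure \<Rightarrow> real measure" where
  "mult_conv M N = distr (M \<Otimes>\<^sub>M N) borel (\<lambda>(x, y). x * y)"

primrec mult_conv_pow :: "real measure \<Rightarrow> nat \<Rightarrow> real measure" where
  "mult_conv_pow M 0 = return borel 1"
| "mult_conv_pow M (Suc n) = mult_conv M (mult_conv_pow M n)"

definition pos_law :: "real measure \<Rightarrow> bool" where
  "pos_law M \<longleftrightarrow> prob_space M \<and> sets M = sets borel \<and> (AE x in M. 0 < x)"

lemma pos_lawD:
  assumes "pos_law M"
  shows "prob_space M" "sets M = sets borel" "space M = UNIV" "AE x in M. 0 < x"
    "borel_measurable M = borel_measurable borel"
proof -
  show s: "sets M = sets borel" using assms by (simp add: pos_law_def)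
  show "space M = UNIV" using sets_eq_imp_space_eq[OF s] by simp
  show "borel_measurable M = borel_measurable borel" using measurable_cong_sets[OF s refl] .
qed (use assms in \<open>auto simp: pos_law_def\<close>)

lemma prob_space_mult_conv:
  assumes "prob_space M" "prob_space N" and [measurable_cong]: "sets M = sets borel" "sets N = sets borel"
  shows "prob_space (mult_conv M N)"
proof -
  interpret M: prob_space M by fact
  interpret N: prob_space N by fact
  interpret pair_prob_space M N ..
  show ?thesis unfolding mult_conv_def by (rule prob_space_distr) measurable
qed

lemma pos_law_return: "x > 0 \<Longrightarrow> pos_law (return borel x)"
  unfolding pos_law_def by (auto simp: prob_space_return AE_return)

lemma AE_pair_pos:
  assumes M: "pos_law M" and N: "pos_law N"
  shows "AE z in M \<Otimes>\<^sub>M N. 0 < fst z \<and> 0 < snd z"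
proof -
  note [measurable_cong] = pos_lawD(2)[OF M] pos_lawD(2)[OF N]
  interpret M: prob_space M by (rule pos_lawD(1)[OF M])
  interpret N: prob_space N by (rule pos_lawD(1)[OF N])
  interpret pair_prob_space M N ..
  show ?thesis
  proof (rule AE_pair_measure)
    show "AE x in M. AE y in N. 0 < fst (x, y) \<and> 0 < snd (x, y)"
      using pos_lawD(4)[OF M] by eventually_elim (use pos_lawD(4)[OF N] in simp)
  qed measurable
qed

lemma pos_law_mult_conv:
  assumes M: "pos_law M" and N: "pos_law N"
  shows "pos_law (mult_conv M N)"
proof -
  note [measurable_cong] = pos_lawD(2)[OF M] pos_lawD(2)[OF N]
  interpret M: prob_space M by (rule pos_lawD(1)[OF M])
  interpret N: prob_space N by (rule pos_lawD(1)[OF N])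
  interpret pair_prob_space M N ..
  have "AE z in M \<Otimes>\<^sub>M N. 0 < fst z * snd z"
    using AE_pair_pos[OF M N] by eventually_elim simp
  then show ?thesis
    unfolding pos_law_def mult_conv_def
    using prob_space_mult_conv[OF pos_lawD(1)[OF M] pos_lawD(1)[OF N] pos_lawD(2)[OF M] pos_lawD(2)[OF N]]
    by (auto simp: mult_conv_def AE_distr_iff case_prod_beta)
qed

lemma pos_law_mult_conv_pow: "pos_law M \<Longrightarrow> pos_law (mult_conv_pow M n)"
  by (induction n) (auto intro: pos_law_return pos_law_mult_conv)

text \<open>Replaces the product space in \<open>R_law\<close> by iterated convolution, so that
  later inductions meet only two independent factors at a time.\<close>

lemma distr_PiM_prod:
  assumes M: "prob_space M" and [measurable_cong]: "sets M = sets borel"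
  shows "distr (PiM {..<n} (\<lambda>_. M)) borel (\<lambda>x. \<Prod>j<n. x j) = mult_conv_pow M n"
proof (induction n)
  case 0
  interpret prob_space "PiM {} (\<lambda>_. M)" by (rule prob_space_PiM) (rule M)
  show ?case by (simp add: distr_const)
next
  case (Suc n)
  interpret M: prob_space M by (rule M)
  interpret Pn: prob_space "PiM {..<n} (\<lambda>_. M)" by (rule prob_space_PiM) (rule M)
  have "PiM {..<Suc n} (\<lambda>_. M) = distr (M \<Otimes>\<^sub>M PiM {..<n} (\<lambda>_. M)) (PiM {..<Suc n} (\<lambda>_. M)) (\<lambda>(x, X). X(n := x))"
    using distr_pair_PiM_eq_PiM[of "{..<n}" "\<lambda>_. M" n] M by (simp add: lessThan_Suc)
  then have "distr (PiM {..<Suc n} (\<lambda>_. M)) borel (\<lambda>x. \<Prod>j<Suc n. x j) =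
      distr (distr (M \<Otimes>\<^sub>M PiM {..<n} (\<lambda>_. M)) (PiM {..<Suc n} (\<lambda>_. M)) (\<lambda>(x, X). X(n := x))) borel (\<lambda>x. \<Prod>j<Suc n. x j)"
    by simp
  also have "\<dots> = distr (M \<Otimes>\<^sub>M PiM {..<n} (\<lambda>_. M)) borel ((\<lambda>x. \<Prod>j<Suc n. x j) \<circ> (\<lambda>(x, X). X(n := x)))"
  proof (rule distr_distr)
    have "(\<lambda>(x, X). X(n := x)) \<in> measurable (M \<Otimes>\<^sub>M PiM {..<n} (\<lambda>_. M)) (PiM (insert n {..<n}) (\<lambda>_. M))"
      by measurable
    then show "(\<lambda>(x, X). X(n := x)) \<in> measurable (M \<Otimes>\<^sub>M PiM {..<n} (\<lambda>_. M)) (PiM {..<Suc n} (\<lambda>_. M))"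
      by (simp add: lessThan_Suc)
  qed measurable
  also have "\<dots> = distr (M \<Otimes>\<^sub>M PiM {..<n} (\<lambda>_. M)) borel ((\<lambda>(x, y). x * y) \<circ> (\<lambda>(x, X). (x, \<Prod>j<n. X j)))"
    by (rule arg_cong[where f = "distr _ _"]) (auto simp: fun_eq_iff lessThan_Suc)
  also have "\<dots> = distr (distr (M \<Otimes>\<^sub>M PiM {..<n} (\<lambda>_. M)) (borel \<Otimes>\<^sub>M borel) (\<lambda>(x, X). (x, \<Prod>j<n. X j))) borel (\<lambda>(x, y). x * y)"
    by (rule distr_distr[symmetric]) measurable
  also have "distr (M \<Otimes>\<^sub>M PiM {..<n} (\<lambda>_. M)) (borel \<Otimes>\<^sub>M borel) (\<lambda>(x, X). (x, \<Prod>j<n. X j))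
      = distr M borel (\<lambda>x. x) \<Otimes>\<^sub>M distr (PiM {..<n} (\<lambda>_. M)) borel (\<lambda>X. \<Prod>j<n. X j)"
    by (rule pair_measure_distr[symmetric])
       (auto intro!: prob_space_imp_sigma_finite Pn.prob_space_distr)
  also have "distr M borel (\<lambda>x. x) = M"
    by (rule distr_id2) (simp add: assms)
  finally show ?case by (simp add: Suc mult_conv_def)
qed

definition affine_law :: "real \<Rightarrow> real measure \<Rightarrow> real measure" where
  "affine_law b M = distr M borel (\<lambda>p. (p + b - 1) / b)"

lemma R_law_Suc_conv:
  assumes R: "prob_space (R_law s b \<mu> \<beta> h n)" "sets (R_law s b \<mu> \<beta> h n) = sets borel"
    and A: "prob_space (A_law \<mu> \<beta> h)"
  shows "R_law s b \<mu> \<beta> h (Suc n) =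
    affine_law b (mult_conv (mult_conv_pow (R_law s b \<mu> \<beta> h n) s) (mult_conv_pow (A_law \<mu> \<beta> h) (s - 1)))"
proof -
  let ?R = "R_law s b \<mu> \<beta> h n" and ?A = "A_law \<mu> \<beta> h"
  let ?PR = "PiM {..<s} (\<lambda>_. ?R)" and ?PA = "PiM {..<s - 1} (\<lambda>_. ?A)"
  have sA: "sets ?A = sets borel" by (simp add: A_law_def)
  note [measurable_cong] = R(2) sA
  interpret PA: prob_space ?PA by (rule prob_space_PiM) (rule A)
  have "R_law s b \<mu> \<beta> h (Suc n) =
    distr (?PR \<Otimes>\<^sub>M ?PA) borel ((\<lambda>p. (p + b - 1) / b) \<circ> ((\<lambda>(x, y). x * y) \<circ> (\<lambda>(r, a). (\<Prod>j<s. r j, \<Prod>j<s - 1. a j))))"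
    by (auto intro!: arg_cong[where f = "distr _ _"])
  also have "\<dots> = affine_law b (distr (?PR \<Otimes>\<^sub>M ?PA) borel ((\<lambda>(x, y). x * y) \<circ> (\<lambda>(r, a). (\<Prod>j<s. r j, \<Prod>j<s - 1. a j))))"
    unfolding affine_law_def by (rule distr_distr[symmetric]) measurable
  also have "distr (?PR \<Otimes>\<^sub>M ?PA) borel ((\<lambda>(x, y). x * y) \<circ> (\<lambda>(r, a). (\<Prod>j<s. r j, \<Prod>j<s - 1. a j)))
     = distr (distr (?PR \<Otimes>\<^sub>M ?PA) (borel \<Otimes>\<^sub>M borel) (\<lambda>(r, a). (\<Prod>j<s. r j, \<Prod>j<s - 1. a j))) borel (\<lambda>(x, y). x * y)"
    by (rule distr_distr[symmetric]) measurable
  also have "distr (?PR \<Otimes>\<^sub>M ?PA) (borel \<Otimes>\<^sub>M borel) (\<lambda>(r, a). (\<Prod>j<s. r j, \<Prod>j<s - 1. a j)) =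
      distr ?PR borel (\<lambda>r. \<Prod>j<s. r j) \<Otimes>\<^sub>M distr ?PA borel (\<lambda>a. \<Prod>j<s - 1. a j)"
    by (intro pair_measure_distr[symmetric] prob_space_imp_sigma_finite PA.prob_space_distr) measurable
  finally show ?thesis
    by (simp add: distr_PiM_prod R A sA mult_conv_def)
qed

text \<open>Fubini. Asking for multiplicativity at positive arguments only lets \<open>x\<close>,
  \<open>x\<^sup>2\<close> and \<open>x powr \<theta>\<close> share this lemma, and likewise admits
  \<open>ln\<close> in the additive version.\<close>

lemma has_bochner_integral_mult_conv:
  fixes f :: "real \<Rightarrow> real"
  assumes M: "pos_law M" and N: "pos_law N" and [measurable]: "f \<in> borel_measurable borel"
    and mult: "\<And>x y. 0 < x \<Longrightarrow> 0 < y \<Longrightarrow> f (x * y) = f x * f y"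
    and u: "has_bochner_integral M f u" and v: "has_bochner_integral N f v"
  shows "has_bochner_integral (mult_conv M N) f (u * v)"
proof -
  note [measurable_cong] = pos_lawD(2)[OF M] pos_lawD(2)[OF N]
  interpret M: prob_space M by (rule pos_lawD(1)[OF M])
  interpret N: prob_space N by (rule pos_lawD(1)[OF N])
  interpret pair_prob_space M N ..
  have iM: "integrable M f" "integral\<^sup>L M f = u" and iN: "integrable N f" "integral\<^sup>L N f = v"
    using u v by (auto simp: has_bochner_integral_iff)
  have int: "integrable (M \<Otimes>\<^sub>M N) (\<lambda>z. f (fst z) * f (snd z))"
    by (rule Fubini_integrable) (use iM iN in \<open>auto simp: abs_mult\<close>)
  have val: "integral\<^sup>L (M \<Otimes>\<^sub>M N) (\<lambda>z. f (fst z) * f (snd z)) = u * v"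
    using integral_fst'[OF int] iM iN by simp
  have ae: "AE z in M \<Otimes>\<^sub>M N. f (fst z * snd z) = f (fst z) * f (snd z)"
    using AE_pair_pos[OF M N] by eventually_elim (simp add: mult)
  have "has_bochner_integral (M \<Otimes>\<^sub>M N) (\<lambda>z. f (fst z * snd z)) (u * v)"
    unfolding has_bochner_integral_iff
    using int val integrable_cong_AE[OF _ _ ae] integral_cong_AE[OF _ _ ae] by simp
  then show ?thesis
    unfolding mult_conv_def by (intro has_bochner_integral_distr) (auto simp: case_prod_beta)
qed

lemma has_bochner_integral_mult_conv_add:
  fixes f :: "real \<Rightarrow> real"
  assumes M: "pos_law M" and N: "pos_law N" and [measurable]: "f \<in> borel_measurable borel"
    and add: "\<And>x y. 0 < x \<Longrightarrow> 0 < y \<Longrightarrow> f (x * y) = f x + f y"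
    and u: "has_bochner_integral M f u" and v: "has_bochner_integral N f v"
  shows "has_bochner_integral (mult_conv M N) f (u + v)"
proof -
  note [measurable_cong] = pos_lawD(2)[OF M] pos_lawD(2)[OF N]
  interpret M: prob_space M by (rule pos_lawD(1)[OF M])
  interpret N: prob_space N by (rule pos_lawD(1)[OF N])
  interpret pair_prob_space M N ..
  have iM: "integrable M f" "integral\<^sup>L M f = u" and iN: "integrable N f" "integral\<^sup>L N f = v"
    using u v by (auto simp: has_bochner_integral_iff)
  have int1: "integrable (M \<Otimes>\<^sub>M N) (\<lambda>z. f (fst z))"
    by (rule Fubini_integrable) (use iM iN in auto)
  have int2: "integrable (M \<Otimes>\<^sub>M N) (\<lambda>z. f (snd z))"
    by (rule Fubini_integrable) (use iM iN in auto)
  have val: "integral\<^sup>L (M \<Otimes>\<^sub>M N) (\<lambda>z. f (fst z) + f (snd z)) = u + v"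
    using integral_fst'[OF int1] integral_fst'[OF int2] iM iN int1 int2
    by (simp add: M.prob_space N.prob_space)
  have ae: "AE z in M \<Otimes>\<^sub>M N. f (fst z * snd z) = f (fst z) + f (snd z)"
    using AE_pair_pos[OF M N] by eventually_elim (simp add: add)
  have "has_bochner_integral (M \<Otimes>\<^sub>M N) (\<lambda>z. f (fst z * snd z)) (u + v)"
    unfolding has_bochner_integral_iff
    using int1 int2 val integrable_cong_AE[OF _ _ ae] integral_cong_AE[OF _ _ ae] by simp
  then show ?thesis
    unfolding mult_conv_def by (intro has_bochner_integral_distr) (auto simp: case_prod_beta)
qed

lemma has_bochner_integral_return:
  fixes f :: "real \<Rightarrow> real"
  assumes [measurable]: "f \<in> borel_measurable borel"
  shows "has_bochner_integral (return borel x) f (f x)"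
  by (simp add: has_bochner_integral_iff integral_return integrable_iff_bounded nn_integral_return)

lemma has_bochner_integral_mult_conv_pow:
  fixes f :: "real \<Rightarrow> real"
  assumes M: "pos_law M" and f: "f \<in> borel_measurable borel" "f 1 = 1"
    and mult: "\<And>x y. 0 < x \<Longrightarrow> 0 < y \<Longrightarrow> f (x * y) = f x * f y"
    and u: "has_bochner_integral M f u"
  shows "has_bochner_integral (mult_conv_pow M n) f (u ^ n)"
proof (induction n)
  case 0
  show ?case using has_bochner_integral_return[OF f(1), of 1] f(2) by simp
next
  case (Suc n)
  show ?case
    using has_bochner_integral_mult_conv[OF M pos_law_mult_conv_pow[OF M] f(1) mult u Suc] by simp
qed

lemma has_bochner_integral_mult_conv_pow_add:
  fixes f :: "real \<Rightarrow> real"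
  assumes M: "pos_law M" and f: "f \<in> borel_measurable borel" "f 1 = 0"
    and add: "\<And>x y. 0 < x \<Longrightarrow> 0 < y \<Longrightarrow> f (x * y) = f x + f y"
    and u: "has_bochner_integral M f u"
  shows "has_bochner_integral (mult_conv_pow M n) f (real n * u)"
proof (induction n)
  case 0
  show ?case using has_bochner_integral_return[OF f(1), of 1] f(2) by simp
next
  case (Suc n)
  show ?case
    using has_bochner_integral_mult_conv_add[OF M pos_law_mult_conv_pow[OF M] f(1) add u Suc]
    by (simp add: algebra_simps)
qed

section \<open>The recursion and the free energy\<close>

lemma exp_le_quadratic_nonpos:
  fixes y :: real
  assumes "y \<le> 0"
  shows "exp y \<le> 1 + y + y\<^sup>2 / 2"
proof -
  have "\<exists>D. ((\<lambda>z. 1 + z + z\<^sup>2 / 2 - exp z) has_real_derivative D) (at z) \<and> D \<le> 0" for z :: real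
    using exp_ge_add_one_self[of z]
    by (intro exI[of _ "1 + z - exp z"] conjI) (auto intro!: derivative_eq_intros)
  then have "(1 + y + y\<^sup>2 / 2 - exp y) \<ge> (1 + 0 + 0\<^sup>2 / 2 - exp (0::real))"
    using assms by (intro DERIV_nonpos_imp_nonincreasing[where f = "\<lambda>z. 1 + z + z\<^sup>2 / 2 - exp z"]) auto
  then show ?thesis by simp
qed

lemma exp_le_quadratic:
  fixes y :: real
  assumes "y \<le> 1"
  shows "exp y \<le> 1 + y + y\<^sup>2"
proof (cases "y \<ge> 0")
  case False
  then have "exp y \<le> 1 + y + y\<^sup>2 / 2" by (intro exp_le_quadratic_nonpos) simp
  then show ?thesis using zero_le_power2[of y] by linarith
qed (use assms exp_bound[of y] in auto)

text \<open>The remainder has to be integrable uniformly in \<open>t\<close> although only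
  right-tail exponential moments are at hand. For \<open>x \<le> 0\<close> the Taylor remainder is
  at most \<open>(t * x)\<^sup>2 / 2\<close>; for \<open>x > 0\<close>,
  \<open>x\<^sup>2 / 2 \<le> exp x\<close> and \<open>exp (t * x) \<le> exp (2 * x)\<close> combine
  to \<open>exp (3 * x)\<close>. The range up to 2 accommodates
  \<open>mgf \<mu> (2 * \<beta>)\<close> with \<open>\<beta> \<le> 1\<close>.\<close>

lemma exp_le_quadratic_plus_exp:
  fixes x t :: real
  assumes "0 \<le> t" "t \<le> 2"
  shows "exp (t * x) \<le> 1 + t * x + t\<^sup>2 * (x\<^sup>2 + exp (3 * x))"
proof -
  have taylor: "exp y \<le> 1 + y + y\<^sup>2 / 2 * exp (max y 0)" for y :: real
  proof -
    obtain u where u: "\<bar>u\<bar> \<le> \<bar>y\<bar>" "exp y = (\<Sum>m<2. y ^ m / fact m) + exp u / fact 2 * y ^ 2"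
      using Maclaurin_exp_le[of y 2] by blast
    have e: "exp y = 1 + y + exp u / 2 * y\<^sup>2"
      using u(2) by (simp add: numeral_2_eq_2)
    show ?thesis
    proof (cases "y \<ge> 0")
      case True
      then have "exp u \<le> exp (max y 0)" using u(1) by simp
      from mult_right_mono[OF this, of "y\<^sup>2 / 2"] show ?thesis unfolding e by (simp add: algebra_simps)
    next
      case False
      then show ?thesis using exp_le_quadratic_nonpos[of y] by (simp add: max_def)
    qed
  qed
  show ?thesis
  proof (cases "x \<le> 0")
    case True
    then have "max (t * x) 0 = 0" using assms by (simp add: max_def mult_nonneg_nonpos antisym)
    then have "exp (t * x) \<le> 1 + t * x + (t * x)\<^sup>2 / 2" using taylor[of "t * x"] by simp
    also have "(t * x)\<^sup>2 / 2 \<le> t\<^sup>2 * (x\<^sup>2 + exp (3 * x))"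
    proof -
      have "t\<^sup>2 * (x\<^sup>2 / 2) \<le> t\<^sup>2 * (x\<^sup>2 + exp (3 * x))" by (intro mult_left_mono) (auto simp: add_nonneg_nonneg)
      then show ?thesis by (simp add: power_mult_distrib)
    qed
    finally show ?thesis by simp
  next
    case False
    then have x: "x > 0" by simp
    have "x\<^sup>2 / 2 \<le> exp x" using exp_lower_Taylor_quadratic[of x] x by simp
    then have "x\<^sup>2 / 2 * exp (t * x) \<le> exp x * exp (2 * x)"
      using x assms by (intro mult_mono) auto
    also have "\<dots> = exp (3 * x)" by (simp flip: exp_add)
    finally have "x\<^sup>2 / 2 * exp (t * x) \<le> x\<^sup>2 + exp (3 * x)" by (simp add: add_increasing)
    then have "t\<^sup>2 * (x\<^sup>2 / 2 * exp (t * x)) \<le> t\<^sup>2 * (x\<^sup>2 + exp (3 * x))" by (intro mult_left_mono) auto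
    moreover have "max (t * x) 0 = t * x" using x assms by simp
    ultimately show ?thesis using taylor[of "t * x"] by (simp add: power_mult_distrib)
  qed
qed

lemma (in prob_space) has_bochner_integral_affine:
  fixes f :: "'a \<Rightarrow> real"
  assumes "has_bochner_integral M f u"
  shows "has_bochner_integral M (\<lambda>x. c * f x + d) (c * u + d)"
  using assms by (simp add: has_bochner_integral_iff prob_space)

section \<open>Moments of the disorder and positivity of the laws\<close>

locale pinning =
  fixes s :: nat and b :: real and \<mu> :: "real measure"
  assumes s2: "s \<ge> 2" and b1: "b > 1" and omega: "omega_law \<mu>"
begin

lemma prob_mu: "prob_space \<mu>" and sets_mu[measurable_cong]: "sets \<mu> = sets borel"
  and int_id: "integrable \<mu> (\<lambda>x. x)" "(\<integral>x. x \<partial>\<mu>) = 0"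
  and int_sq: "integrable \<mu> (\<lambda>x. x\<^sup>2)" "(\<integral>x. x\<^sup>2 \<partial>\<mu>) = 1"
  and int_exp: "t > 0 \<Longrightarrow> integrable \<mu> (\<lambda>x. exp (t * x))"
  using omega unfolding omega_law_def by auto

sublocale mu: prob_space \<mu> by (rule prob_mu)

lemma mgf_ge_1:
  assumes "t > 0" shows "1 \<le> mgf \<mu> t"
proof -
  have "(\<integral>x. 1 + t * x \<partial>\<mu>) \<le> (\<integral>x. exp (t * x) \<partial>\<mu>)"
    using int_id(1) int_exp[OF assms] exp_ge_add_one_self by (intro integral_mono) auto
  then show ?thesis using int_id by (simp add: mgf_def mu.prob_space)
qed

lemma mgf_le:
  assumes "t > 0" "t \<le> 2" shows "mgf \<mu> t \<le> 1 + t\<^sup>2 * (1 + mgf \<mu> 3)"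
proof -
  have "(\<integral>x. exp (t * x) \<partial>\<mu>) \<le> (\<integral>x. 1 + t * x + t\<^sup>2 * (x\<^sup>2 + exp (3 * x)) \<partial>\<mu>)"
    using int_id(1) int_sq(1) int_exp[of 3] int_exp[OF assms(1)] exp_le_quadratic_plus_exp[of t] assms
    by (intro integral_mono) auto
  also have "\<dots> = 1 + t\<^sup>2 * (1 + mgf \<mu> 3)"
    using int_id int_sq int_exp[of 3] by (simp add: mgf_def mu.prob_space)
  finally show ?thesis by (simp add: mgf_def)
qed

context
  fixes \<beta> :: real
  assumes beta: "\<beta> > 0"
begin

lemma mgf_pos: "mgf \<mu> \<beta> > 0" using mgf_ge_1[OF beta] by simp

lemma A_pos_law: "pos_law (A_law \<mu> \<beta> h)"
  unfolding pos_law_def A_law_def by (auto intro!: mu.prob_space_distr simp: AE_distr_iff)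

lemma A_mean: "has_bochner_integral (A_law \<mu> \<beta> h) (\<lambda>x. x) (exp h)"
proof -
  have "has_bochner_integral \<mu> (\<lambda>w. exp (\<beta> * w)) (mgf \<mu> \<beta>)"
    using int_exp[OF beta] by (simp add: has_bochner_integral_iff mgf_def)
  then have "has_bochner_integral \<mu> (\<lambda>w. exp (\<beta> * w) * (exp h / mgf \<mu> \<beta>)) (mgf \<mu> \<beta> * (exp h / mgf \<mu> \<beta>))"
    by (rule has_bochner_integral_mult_left)
  then have "has_bochner_integral \<mu> (\<lambda>w. exp (\<beta> * w - ln (mgf \<mu> \<beta>) + h)) (exp h)"
    using mgf_pos by (simp add: exp_add exp_diff)
  then show ?thesis unfolding A_law_def by (intro has_bochner_integral_distr) auto
qed

lemma A_second_moment:
  "has_bochner_integral (A_law \<mu> \<beta> h) (\<lambda>x. x\<^sup>2) ((exp h)\<^sup>2 * (mgf \<mu> (2 * \<beta>) / (mgf \<mu> \<beta>)\<^sup>2))"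
proof -
  have "has_bochner_integral \<mu> (\<lambda>w. exp (2 * \<beta> * w)) (mgf \<mu> (2 * \<beta>))"
    using int_exp[of "2 * \<beta>"] beta by (simp add: has_bochner_integral_iff mgf_def)
  then have "has_bochner_integral \<mu> (\<lambda>w. exp (2 * \<beta> * w) * (exp h / mgf \<mu> \<beta>)\<^sup>2) (mgf \<mu> (2 * \<beta>) * (exp h / mgf \<mu> \<beta>)\<^sup>2)"
    by (rule has_bochner_integral_mult_left)
  moreover have "exp (2 * \<beta> * w) * (exp h / mgf \<mu> \<beta>)\<^sup>2 = (exp (\<beta> * w - ln (mgf \<mu> \<beta>) + h))\<^sup>2" for w
    using mgf_pos by (simp add: exp_add exp_diff power_mult_distrib power_divide exp_double mult.assoc)
  ultimately have "has_bochner_integral \<mu> (\<lambda>w. (exp (\<beta> * w - ln (mgf \<mu> \<beta>) + h))\<^sup>2) ((exp h)\<^sup>2 * (mgf \<mu> (2 * \<beta>) / (mgf \<mu> \<beta>)\<^sup>2))"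
    by (simp add: power_divide mult.commute)
  then show ?thesis unfolding A_law_def by (intro has_bochner_integral_distr) auto
qed

lemma A_ln: "has_bochner_integral (A_law \<mu> \<beta> h) ln (h - ln (mgf \<mu> \<beta>))"
proof -
  have "has_bochner_integral \<mu> (\<lambda>w. \<beta> * w + (h - ln (mgf \<mu> \<beta>))) (\<beta> * 0 + (h - ln (mgf \<mu> \<beta>)))"
    using int_id by (simp add: has_bochner_integral_iff mu.prob_space)
  then have "has_bochner_integral \<mu> (\<lambda>w. ln (exp (\<beta> * w - ln (mgf \<mu> \<beta>) + h))) (h - ln (mgf \<mu> \<beta>))"
    by (simp add: algebra_simps)
  then show ?thesis unfolding A_law_def by (intro has_bochner_integral_distr) auto
qed

abbreviation R :: "real \<Rightarrow> nat \<Rightarrow> real measure" where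
  "R h n \<equiv> R_law s b \<mu> \<beta> h n"

abbreviation P_law :: "real \<Rightarrow> nat \<Rightarrow> real measure" where
  "P_law h n \<equiv> mult_conv (mult_conv_pow (R h n) s) (mult_conv_pow (A_law \<mu> \<beta> h) (s - 1))"

lemma pos_law_affine:
  assumes M: "pos_law M" shows "pos_law (affine_law b M)"
    and "AE x in affine_law b M. (b - 1) / b \<le> x"
proof -
  note [measurable_cong] = pos_lawD(2)[OF M]
  interpret prob_space M by (rule pos_lawD(1)[OF M])
  have "AE x in M. 0 < (x + b - 1) / b" and ge: "AE x in M. (b - 1) / b \<le> (x + b - 1) / b"
    using pos_lawD(4)[OF M] by (eventually_elim, use b1 in \<open>auto simp: divide_simps\<close>)+
  then show "pos_law (affine_law b M)"
    unfolding pos_law_def affine_law_def by (auto intro!: prob_space_distr simp: AE_distr_iff)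
  show "AE x in affine_law b M. (b - 1) / b \<le> x"
    unfolding affine_law_def by (subst AE_distr_iff) (use ge in auto)
qed

text \<open>Unfolding the recursion presupposes a probability law at level \<open>n\<close>, which
  is itself obtained by unfolding. Hence these conditional forms, discharged by the induction in
  \<open>R_pos_law\<close>.\<close>

lemma R_Suc_if_pos: "pos_law (R h n) \<Longrightarrow> R h (Suc n) = affine_law b (P_law h n)"
  using pos_lawD(1,2) A_pos_law by (intro R_law_Suc_conv) auto

lemma P_pos_law_if_pos: "pos_law (R h n) \<Longrightarrow> pos_law (P_law h n)"
  by (intro pos_law_mult_conv pos_law_mult_conv_pow A_pos_law)

lemma R_pos_law: "pos_law (R h n)"
proof (induction n)
  case (Suc n)
  then show ?case using pos_law_affine(1)[OF P_pos_law_if_pos[OF Suc]] by (simp only: R_Suc_if_pos)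
qed (auto intro: pos_law_return)

lemma R_Suc: "R h (Suc n) = affine_law b (P_law h n)"
  by (rule R_Suc_if_pos[OF R_pos_law])

lemma P_pos_law: "pos_law (P_law h n)"
  by (rule P_pos_law_if_pos[OF R_pos_law])

text \<open>The deterministic floor left by the weight \<open>b - 1\<close>. It makes
  \<open>ln\<close> integrable and caps the loss on the event that \<open>R_n\<close> is atypically
  small.\<close>

lemma R_ge: "AE x in R h n. (b - 1) / b \<le> x"
proof (cases n)
  case 0
  have "AE x in return borel (1::real). (b - 1) / b \<le> x"
    using b1 by (subst AE_return) auto
  then show ?thesis by (simp only: 0 R_law.simps)
next
  case (Suc k)
  then show ?thesis using pos_law_affine(2)[OF P_pos_law[of h k]] by (simp only: R_Suc)
qed

lemma P_integral_mult:
  fixes f :: "real \<Rightarrow> real"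
  assumes f: "f \<in> borel_measurable borel" "f 1 = 1"
    and mult: "\<And>x y. 0 < x \<Longrightarrow> 0 < y \<Longrightarrow> f (x * y) = f x * f y"
    and "has_bochner_integral (R h n) f u" "has_bochner_integral (A_law \<mu> \<beta> h) f v"
  shows "has_bochner_integral (P_law h n) f (u ^ s * v ^ (s - 1))"
  by (intro has_bochner_integral_mult_conv has_bochner_integral_mult_conv_pow
      pos_law_mult_conv_pow R_pos_law A_pos_law assms)

lemma P_integral_add:
  fixes f :: "real \<Rightarrow> real"
  assumes f: "f \<in> borel_measurable borel" "f 1 = 0"
    and mult: "\<And>x y. 0 < x \<Longrightarrow> 0 < y \<Longrightarrow> f (x * y) = f x + f y"
    and "has_bochner_integral (R h n) f u" "has_bochner_integral (A_law \<mu> \<beta> h) f v"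
  shows "has_bochner_integral (P_law h n) f (real s * u + real (s - 1) * v)"
  by (intro has_bochner_integral_mult_conv_add has_bochner_integral_mult_conv_pow_add
      pos_law_mult_conv_pow R_pos_law A_pos_law assms)

lemma R_Suc_integral:
  fixes f :: "real \<Rightarrow> real"
  assumes "f \<in> borel_measurable borel"
    and "has_bochner_integral (P_law h n) (\<lambda>p. f ((p + b - 1) / b)) u"
  shows "has_bochner_integral (R h (Suc n)) f u"
  unfolding R_Suc affine_law_def
  by (rule has_bochner_integral_distr) (use assms in \<open>simp_all add: pos_lawD(5)[OF P_pos_law] del: One_nat_def\<close>)

end

section \<open>Annealed mean, superadditivity and existence of the free energy\<close>

primrec annealed :: "real \<Rightarrow> nat \<Rightarrow> real" where
  "annealed h 0 = 1"
| "annealed h (Suc n) = (annealed h n ^ s * exp h ^ (s - 1) + b - 1) / b"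

lemma annealed_pos: "annealed h n > 0"
  using b1 by (induction n) (auto intro!: divide_pos_pos add_pos_pos simp: add_diff_eq[symmetric])

text \<open>\<open>s ^ n - 1\<close> is the number of disorder variables in \<open>R_n\<close>, the
  solution of \<open>N' = s * N + (s - 1)\<close> started at 0.\<close>

lemma annealed_le: "annealed h n \<le> exp (real (s ^ n - 1) * max h 0)"
proof (induction n)
  case (Suc n)
  have "annealed h n ^ s * exp h ^ (s - 1) \<le> exp (real (s ^ n - 1) * max h 0) ^ s * exp (max h 0) ^ (s - 1)"
    using Suc annealed_pos[of h n] by (intro mult_mono power_mono) auto
  also have "\<dots> = exp ((real s * real (s ^ n - 1) + real (s - 1)) * max h 0)"
    by (simp only: exp_of_nat_mult[symmetric] exp_add[symmetric] distrib_right mult.assoc)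
  also have "real s * real (s ^ n - 1) + real (s - 1) = real (s ^ Suc n - 1)"
    using s2 by (simp add: of_nat_diff algebra_simps)
  finally have *: "annealed h n ^ s * exp h ^ (s - 1) \<le> exp (real (s ^ Suc n - 1) * max h 0)" .
  have "1 \<le> exp (real (s ^ Suc n - 1) * max h 0)" by simp
  then have "b - 1 \<le> (b - 1) * exp (real (s ^ Suc n - 1) * max h 0)" using b1 by simp
  then have "annealed h n ^ s * exp h ^ (s - 1) + b - 1 \<le> b * exp (real (s ^ Suc n - 1) * max h 0)"
    using * by (simp add: algebra_simps)
  then show ?case using b1 by (simp add: divide_simps mult.commute)
qed auto

context
  fixes \<beta> :: real
  assumes beta: "\<beta> > 0"
begin

lemma R_mean: "has_bochner_integral (R_law s b \<mu> \<beta> h n) (\<lambda>x. x) (annealed h n)"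
proof (induction n)
  case 0
  show ?case using has_bochner_integral_return[of "\<lambda>x. x" 1] by simp
next
  case (Suc n)
  interpret P: prob_space "P_law \<beta> h n" by (rule pos_lawD(1)[OF P_pos_law[OF beta]])
  have "has_bochner_integral (P_law \<beta> h n) (\<lambda>x. x) (annealed h n ^ s * exp h ^ (s - 1))"
    by (rule P_integral_mult[OF beta _ _ _ Suc A_mean[OF beta]]) auto
  from P.has_bochner_integral_affine[OF this, of "1 / b" "(b - 1) / b"]
  have "has_bochner_integral (P_law \<beta> h n) (\<lambda>p. (p + b - 1) / b) (annealed h (Suc n))"
    using b1 by (simp add: add_divide_distrib diff_divide_distrib algebra_simps)
  then show ?case by (intro R_Suc_integral[OF beta]) auto
qed

lemma R_ln_integrable: "integrable (R_law s b \<mu> \<beta> h n) ln"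
proof -
  note M = R_pos_law[OF beta, of h n]
  interpret prob_space "R_law s b \<mu> \<beta> h n" by (rule pos_lawD(1)[OF M])
  show ?thesis
  proof (rule Bochner_Integration.integrable_bound[where f = "\<lambda>x. \<bar>ln ((b - 1) / b)\<bar> + x"])
    show "integrable (R_law s b \<mu> \<beta> h n) (\<lambda>x. \<bar>ln ((b - 1) / b)\<bar> + x)"
      using R_mean[of h n] by (auto simp: has_bochner_integral_iff)
    show "AE x in R_law s b \<mu> \<beta> h n. norm (ln x) \<le> norm (\<bar>ln ((b - 1) / b)\<bar> + x)"
      using R_ge[OF beta, of h n]
    proof eventually_elim
      case (elim x)
      have "0 < (b - 1) / b" using b1 by simp
      then have "ln ((b - 1) / b) \<le> ln x" "ln x \<le> x - 1" "0 < x"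
        using elim ln_le_minus_one[of x] by auto
      then show ?case by auto
    qed
  qed (simp add: pos_lawD(5)[OF M])
qed

lemma R_ln_le: "(\<integral>x. ln x \<partial>R_law s b \<mu> \<beta> h n) \<le> ln (annealed h n)"
proof -
  note M = R_pos_law[OF beta, of h n]
  interpret prob_space "R_law s b \<mu> \<beta> h n" by (rule pos_lawD(1)[OF M])
  have "(\<integral>x. ln x \<partial>R_law s b \<mu> \<beta> h n) \<le> (\<integral>x. ln (annealed h n) + (x / annealed h n - 1) \<partial>R_law s b \<mu> \<beta> h n)"
  proof (rule integral_mono_AE)
    show "AE x in R_law s b \<mu> \<beta> h n. ln x \<le> ln (annealed h n) + (x / annealed h n - 1)"
      using pos_lawD(4)[OF M]
    proof eventually_elim
      case (elim x)
      then have "ln (x / annealed h n) \<le> x / annealed h n - 1"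
        using annealed_pos[of h n] by (intro ln_le_minus_one) auto
      then show ?case using elim annealed_pos[of h n] by (simp add: ln_div)
    qed
  qed (use R_ln_integrable R_mean[of h n] in \<open>auto simp: has_bochner_integral_iff\<close>)
  also have "\<dots> = ln (annealed h n)"
    using R_mean[of h n] annealed_pos[of h n] by (simp add: has_bochner_integral_iff prob_space)
  finally show ?thesis .
qed

text \<open>Discarding \<open>b - 1 > 0\<close> leaves a product divided by \<open>b\<close>, whose
  logarithm is a sum of independent terms.\<close>

lemma R_ln_Suc_ge:
  "(\<integral>x. ln x \<partial>R_law s b \<mu> \<beta> h (Suc n)) \<ge>
     real s * (\<integral>x. ln x \<partial>R_law s b \<mu> \<beta> h n) + real (s - 1) * (h - ln (mgf \<mu> \<beta>)) - ln b"
proof -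
  note M = P_pos_law[OF beta, of h n]
  interpret P: prob_space "P_law \<beta> h n" by (rule pos_lawD(1)[OF M])
  have lnR: "has_bochner_integral (R_law s b \<mu> \<beta> h m) ln (\<integral>x. ln x \<partial>R_law s b \<mu> \<beta> h m)" for m
    using R_ln_integrable[of h m] by (simp add: has_bochner_integral_iff)
  have lnP: "has_bochner_integral (P_law \<beta> h n) ln
      (real s * (\<integral>x. ln x \<partial>R_law s b \<mu> \<beta> h n) + real (s - 1) * (h - ln (mgf \<mu> \<beta>)))"
    by (rule P_integral_add[OF beta _ _ _ lnR A_ln[OF beta]]) (auto simp: ln_mult)
  have meas: "(\<lambda>p. (p + b - 1) / b) \<in> measurable (P_law \<beta> h n) borel"
    unfolding pos_lawD(5)[OF M] by measurable
  have int: "integrable (P_law \<beta> h n) (\<lambda>p. ln ((p + b - 1) / b))"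
    using R_ln_integrable[of h "Suc n"] unfolding R_Suc[OF beta] affine_law_def
    by (rule integrable_distr[OF meas])
  have lnP': "has_bochner_integral (P_law \<beta> h n) (\<lambda>p. ln p - ln b)
      (real s * (\<integral>x. ln x \<partial>R_law s b \<mu> \<beta> h n) + real (s - 1) * (h - ln (mgf \<mu> \<beta>)) - ln b)"
    using P.has_bochner_integral_affine[OF lnP, of 1 "- ln b"] by simp
  have "(\<integral>p. ln p - ln b \<partial>P_law \<beta> h n) \<le> (\<integral>p. ln ((p + b - 1) / b) \<partial>P_law \<beta> h n)"
  proof (rule integral_mono_AE)
    show "AE p in P_law \<beta> h n. ln p - ln b \<le> ln ((p + b - 1) / b)"
      using pos_lawD(4)[OF M]
    proof eventually_elim
      case (elim p)
      then have "ln (p / b) \<le> ln ((p + b - 1) / b)" using b1 by (intro ln_mono) (auto simp: divide_simps)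
      then show ?case using elim b1 by (simp add: ln_div)
    qed
  qed (use lnP' int in \<open>simp_all add: has_bochner_integral_iff\<close>)
  also have "\<dots> = (\<integral>x. ln x \<partial>R_law s b \<mu> \<beta> h (Suc n))"
    unfolding R_Suc[OF beta] affine_law_def
    by (rule integral_distr[OF meas, symmetric]) measurable
  finally show ?thesis using lnP' by (simp add: has_bochner_integral_iff)
qed

text \<open>The constant \<open>c\<close> for which \<open>R_ln_Suc_ge\<close> becomes homogeneous:
  \<open>(s - 1) * c\<close> equals the additive term, so \<open>E ln R_n + c\<close> grows at least
  by the factor \<open>s\<close>.\<close>

definition log_offset :: "real \<Rightarrow> real" where
  "log_offset h = h - ln (mgf \<mu> \<beta>) - ln b / real (s - 1)"

lemma shifted_free_energy_incseq:
  "incseq (\<lambda>n. ((\<integral>x. ln x \<partial>R_law s b \<mu> \<beta> h n) + log_offset h) / real s ^ n)"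
proof (rule incseq_SucI)
  fix n
  have "real (s - 1) * log_offset h = real (s - 1) * (h - ln (mgf \<mu> \<beta>)) - ln b"
    using s2 by (simp add: log_offset_def right_diff_distrib)
  then have "real s * log_offset h - log_offset h = real (s - 1) * (h - ln (mgf \<mu> \<beta>)) - ln b"
    using s2 by (simp add: of_nat_diff algebra_simps)
  then have "real s * ((\<integral>x. ln x \<partial>R_law s b \<mu> \<beta> h n) + log_offset h) \<le> (\<integral>x. ln x \<partial>R_law s b \<mu> \<beta> h (Suc n)) + log_offset h"
    using R_ln_Suc_ge[of h n] by (simp only: distrib_left)
  then show "((\<integral>x. ln x \<partial>R_law s b \<mu> \<beta> h n) + log_offset h) / real s ^ n
     \<le> ((\<integral>x. ln x \<partial>R_law s b \<mu> \<beta> h (Suc n)) + log_offset h) / real s ^ Suc n"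
    using s2 by (simp only: power_Suc) (simp add: divide_simps mult.commute)
qed

text \<open>\<open>lim\<close> carries information only once convergence is known. The shifted
  sequence increases and is bounded through Jensen and \<open>annealed_le\<close>; the shift
  vanishes after division by \<open>s ^ n\<close>.\<close>

lemma free_energy_LIMSEQ:
  "(\<lambda>n. ((\<integral>x. ln x \<partial>R_law s b \<mu> \<beta> h n) + log_offset h) / real s ^ n) \<longlonglongrightarrow> free_energy s b \<mu> \<beta> h"
  "(\<lambda>n. (\<integral>x. ln x \<partial>R_law s b \<mu> \<beta> h n) / real s ^ n) \<longlonglongrightarrow> free_energy s b \<mu> \<beta> h"
proof -
  let ?X = "\<lambda>n. (\<integral>x. ln x \<partial>R_law s b \<mu> \<beta> h n)" and ?c = "log_offset h"
  have "(?X n + ?c) / real s ^ n \<le> max h 0 + \<bar>?c\<bar>" for n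
  proof -
    have sn: "real s ^ n \<ge> 1" using s2 by simp
    have "?X n \<le> ln (exp (real (s ^ n - 1) * max h 0))"
      using R_ln_le[of h n] annealed_le[of h n] annealed_pos[of h n] by (meson ln_mono order_trans)
    also have "\<dots> \<le> real s ^ n * max h 0"
      using s2 by (simp add: mult_right_mono of_nat_diff)
    finally have "?X n \<le> real s ^ n * max h 0" .
    moreover have "?c \<le> real s ^ n * \<bar>?c\<bar>" using mult_right_mono[OF sn, of "\<bar>?c\<bar>"] by simp
    ultimately have "?X n + ?c \<le> real s ^ n * (max h 0 + \<bar>?c\<bar>)" by (simp add: distrib_left)
    then show ?thesis using sn by (simp add: divide_simps mult.commute)
  qed
  then have "bdd_above (range (\<lambda>n. (?X n + ?c) / real s ^ n))" by (auto intro!: bdd_aboveI)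
  then obtain l where l: "(\<lambda>n. (?X n + ?c) / real s ^ n) \<longlonglongrightarrow> l"
    using LIMSEQ_incseq_SUP shifted_free_energy_incseq by blast
  have "(\<lambda>n. ?c / real s ^ n) \<longlonglongrightarrow> 0"
    using s2 by (intro LIMSEQ_divide_realpow_zero) auto
  from tendsto_diff[OF l this] have lim: "(\<lambda>n. ?X n / real s ^ n) \<longlonglongrightarrow> l"
    by (simp add: add_divide_distrib)
  then have "free_energy s b \<mu> \<beta> h = l" unfolding free_energy_def by (rule limI)
  with l lim show "(\<lambda>n. (?X n + ?c) / real s ^ n) \<longlonglongrightarrow> free_energy s b \<mu> \<beta> h"
    "(\<lambda>n. ?X n / real s ^ n) \<longlonglongrightarrow> free_energy s b \<mu> \<beta> h" by simp_all
qed

text \<open>By monotonicity, one finite level is enough to certify a positive limit.\<close>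

lemma free_energy_pos_if:
  assumes "(\<integral>x. ln x \<partial>R_law s b \<mu> \<beta> h n) + log_offset h > 0"
  shows "free_energy s b \<mu> \<beta> h > 0"
proof -
  have "((\<integral>x. ln x \<partial>R_law s b \<mu> \<beta> h n) + log_offset h) / real s ^ n > 0"
    using assms s2 by simp
  then show ?thesis
    using incseq_le[OF shifted_free_energy_incseq free_energy_LIMSEQ(1), of h n] by linarith
qed

lemma free_energy_nonpos_if:
  assumes "\<And>m. m \<ge> n \<Longrightarrow> (\<integral>x. ln x \<partial>R_law s b \<mu> \<beta> h m) \<le> 0"
  shows "free_energy s b \<mu> \<beta> h \<le> 0"
  using free_energy_LIMSEQ(2)[of h]
  by (rule LIMSEQ_le_const2) (use assms s2 in \<open>auto intro!: exI[of _ n] divide_nonpos_pos\<close>)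

end

end

section \<open>Second moments and the upper bound\<close>

lemma power_one_plus_le_quadratic:
  fixes w :: real
  assumes "0 \<le> w" "w \<le> 1"
  shows "(1 + w) ^ n \<le> 1 + real n * w + 3 ^ n * w\<^sup>2"
proof (induction n)
  case (Suc n)
  have "(1 + w) ^ Suc n \<le> (1 + real n * w + 3 ^ n * w\<^sup>2) * (1 + w)"
    using mult_right_mono[OF Suc, of "1 + w"] assms by (simp add: mult.commute)
  also have "\<dots> = 1 + real (Suc n) * w + (real n + 3 ^ n + 3 ^ n * w) * w\<^sup>2"
    by (simp add: algebra_simps power2_eq_square)
  also have "real n + 3 ^ n + 3 ^ n * w \<le> 3 ^ n + 3 ^ n + 3 ^ n * 1"
  proof -
    have "n \<le> 3 ^ n" by (rule self_le_ge2_pow) simp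
    then have "real n \<le> 3 ^ n" by (metis of_nat_le_iff of_nat_numeral of_nat_power)
    then show ?thesis using assms by (intro add_mono mult_left_mono) auto
  qed
  finally show ?case by (simp add: mult_right_mono algebra_simps)
qed simp

text \<open>Convexity of \<open>(1 + l * t) ^ n\<close> in \<open>l\<close>, compared with the chord
  from 0 to 1; applied with \<open>l = \<beta>\<^sup>2\<close>.\<close>

lemma power_one_plus_scaled_le:
  fixes t l :: real
  assumes "0 \<le> t" "0 \<le> l" "l \<le> 1"
  shows "(1 + l * t) ^ n \<le> 1 + l * ((1 + t) ^ n - 1)"
proof (induction n)
  case (Suc n)
  define G where "G = (1 + t) ^ n"
  have G: "G \<ge> 1" unfolding G_def using assms by simp
  have "(1 + l * t) ^ Suc n \<le> (1 + l * (G - 1)) * (1 + l * t)"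
    using mult_right_mono[OF Suc, of "1 + l * t"] assms by (simp add: mult.commute G_def)
  also have "\<dots> = 1 + l * (t + (G - 1)) + l * (l * (t * (G - 1)))" by (simp add: algebra_simps)
  also have "l * (l * (t * (G - 1))) \<le> l * (1 * (t * (G - 1)))"
    using assms G by (intro mult_left_mono mult_right_mono) auto
  finally show ?case by (simp add: algebra_simps G_def)
qed simp

context pinning
begin

declare annealed.simps(2) [simp del]

section \<open>Relative variance of the partition function\<close>

text \<open>\<open>E A\<^sup>2 / (E A)\<^sup>2\<close>, from which \<open>h\<close> cancels.\<close>

definition rel_second_moment :: "real \<Rightarrow> real" where
  "rel_second_moment \<beta> = mgf \<mu> (2 * \<beta>) / (mgf \<mu> \<beta>)\<^sup>2"

text \<open>The ratio \<open>Var R_n / (E R_n)\<^sup>2\<close>. The squared factor is the share of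
  the random product in the mean; the rest, coming from \<open>b - 1\<close>, has no
  variance.\<close>

primrec relvar :: "real \<Rightarrow> real \<Rightarrow> nat \<Rightarrow> real" where
  "relvar \<beta> h 0 = 0"
| "relvar \<beta> h (Suc n) = (1 - (b - 1) / (b * annealed h (Suc n)))\<^sup>2 *
     ((1 + relvar \<beta> h n) ^ s * rel_second_moment \<beta> ^ (s - 1) - 1)"

lemma R_second_moment:
  assumes beta: "\<beta> > 0"
  shows "has_bochner_integral (R_law s b \<mu> \<beta> h n) (\<lambda>x. x\<^sup>2) ((annealed h n)\<^sup>2 * (1 + relvar \<beta> h n))"
proof (induction n)
  case 0
  show ?case using has_bochner_integral_return[of "\<lambda>x. x\<^sup>2" 1] by simp
next
  case (Suc n)
  let ?m = "annealed h n" and ?w = "relvar \<beta> h n" and ?\<rho> = "rel_second_moment \<beta>"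
  define P1 where "P1 = ?m ^ s * exp h ^ (s - 1)"
  define F where "F = (1 + ?w) ^ s * ?\<rho> ^ (s - 1)"
  interpret P: prob_space "P_law \<beta> h n" by (rule pos_lawD(1)[OF P_pos_law[OF beta]])
  have i1: "has_bochner_integral (P_law \<beta> h n) (\<lambda>x. x) P1"
    unfolding P1_def by (rule P_integral_mult[OF beta _ _ _ R_mean[OF beta] A_mean[OF beta]]) auto
  have "has_bochner_integral (P_law \<beta> h n) (\<lambda>x. x\<^sup>2) ((?m\<^sup>2 * (1 + ?w)) ^ s * ((exp h)\<^sup>2 * ?\<rho>) ^ (s - 1))"
    unfolding rel_second_moment_def
    by (rule P_integral_mult[OF beta _ _ _ Suc A_second_moment[OF beta]]) (auto simp: power_mult_distrib)
  also have "(?m\<^sup>2 * (1 + ?w)) ^ s * ((exp h)\<^sup>2 * ?\<rho>) ^ (s - 1) = P1\<^sup>2 * F"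
    by (simp add: P1_def F_def power_mult_distrib power_mult[symmetric] mult.commute del: One_nat_def)
  finally have i2: "has_bochner_integral (P_law \<beta> h n) (\<lambda>x. x\<^sup>2) (P1\<^sup>2 * F)" .
  have "has_bochner_integral (P_law \<beta> h n) (\<lambda>x. 1 / b\<^sup>2 * x\<^sup>2 + (2 * (b - 1) / b\<^sup>2 * x + (b - 1)\<^sup>2 / b\<^sup>2))
      (1 / b\<^sup>2 * (P1\<^sup>2 * F) + (2 * (b - 1) / b\<^sup>2 * P1 + (b - 1)\<^sup>2 / b\<^sup>2))"
    by (intro has_bochner_integral_add has_bochner_integral_mult_right i2 P.has_bochner_integral_affine i1)
  also have "(\<lambda>x. 1 / b\<^sup>2 * x\<^sup>2 + (2 * (b - 1) / b\<^sup>2 * x + (b - 1)\<^sup>2 / b\<^sup>2)) = (\<lambda>x. ((x + b - 1) / b)\<^sup>2)"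
    using b1 by (auto simp: fun_eq_iff divide_simps power2_eq_square) (simp add: algebra_simps)
  also have "1 / b\<^sup>2 * (P1\<^sup>2 * F) + (2 * (b - 1) / b\<^sup>2 * P1 + (b - 1)\<^sup>2 / b\<^sup>2)
     = (annealed h (Suc n))\<^sup>2 * (1 + relvar \<beta> h (Suc n))"
  proof -
    have m': "annealed h (Suc n) = (P1 + b - 1) / b" by (simp add: P1_def annealed.simps(2))
    have pos: "P1 + b - 1 > 0" using annealed_pos[of h "Suc n"] b1 unfolding m' by (simp add: zero_less_divide_iff)
    have w': "relvar \<beta> h (Suc n) = (1 - (b - 1) / (b * ((P1 + b - 1) / b)))\<^sup>2 * (F - 1)"
      unfolding relvar.simps m' F_def ..
    have "1 - (b - 1) / (b * ((P1 + b - 1) / b)) = P1 / (P1 + b - 1)"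
      using pos b1 by (simp add: divide_simps)
    then have "(annealed h (Suc n))\<^sup>2 * (1 + relvar \<beta> h (Suc n)) = ((P1 + b - 1)\<^sup>2 + P1\<^sup>2 * (F - 1)) / b\<^sup>2"
      unfolding w' m' using pos b1 by (simp add: divide_simps)
    also have "\<dots> = 1 / b\<^sup>2 * (P1\<^sup>2 * F) + (2 * (b - 1) / b\<^sup>2 * P1 + (b - 1)\<^sup>2 / b\<^sup>2)"
      by (simp add: add_divide_distrib[symmetric] power2_eq_square) (simp add: algebra_simps)
    finally show ?thesis ..
  qed
  finally show ?case by (intro R_Suc_integral[OF beta]) auto
qed

text \<open>A Chebyshev argument in pointwise form: \<open>ln\<close> lies above a downward parabola
  centred at the mean \<open>r\<close>. For \<open>x \<ge> r / 2\<close> this holds since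
  \<open>ln x \<ge> ln (r / 2)\<close>; below, \<open>4 * (x - r)\<^sup>2 \<ge> r\<^sup>2\<close>
  pays for the whole drop \<open>d\<close> to the floor of \<open>R_ge\<close>.\<close>

lemma R_ln_ge:
  assumes beta: "\<beta> > 0" and m: "annealed h n \<ge> 2"
  shows "(\<integral>x. ln x \<partial>R_law s b \<mu> \<beta> h n) \<ge>
    ln (annealed h n / 2) - 4 * relvar \<beta> h n * (ln (annealed h n / 2) - ln ((b - 1) / b))"
proof -
  let ?r = "annealed h n"
  define d where "d = ln (?r / 2) - ln ((b - 1) / b)"
  have k: "0 < (b - 1) / b" "(b - 1) / b < 1" using b1 by auto
  then have "ln ((b - 1) / b) < 0" by simp
  moreover have "ln (?r / 2) \<ge> 0" using m by simp
  ultimately have d: "d > 0" unfolding d_def by linarith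
  note M = R_pos_law[OF beta, of h n]
  interpret prob_space "R_law s b \<mu> \<beta> h n" by (rule pos_lawD(1)[OF M])
  have dev: "has_bochner_integral (R_law s b \<mu> \<beta> h n) (\<lambda>x. x\<^sup>2 + (- 2 * ?r * x + ?r\<^sup>2))
      (?r\<^sup>2 * (1 + relvar \<beta> h n) + (- 2 * ?r * ?r + ?r\<^sup>2))"
    by (intro has_bochner_integral_add has_bochner_integral_affine R_second_moment R_mean beta)
  have q: "has_bochner_integral (R_law s b \<mu> \<beta> h n) (\<lambda>x. (- 4 * d / ?r\<^sup>2) * (x\<^sup>2 + (- 2 * ?r * x + ?r\<^sup>2)) + ln (?r / 2))
      ((- 4 * d / ?r\<^sup>2) * (?r\<^sup>2 * (1 + relvar \<beta> h n) + (- 2 * ?r * ?r + ?r\<^sup>2)) + ln (?r / 2))"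
    by (rule has_bochner_integral_affine[OF dev])
  have "(\<integral>x. (- 4 * d / ?r\<^sup>2) * (x\<^sup>2 + (- 2 * ?r * x + ?r\<^sup>2)) + ln (?r / 2) \<partial>R_law s b \<mu> \<beta> h n)
      \<le> (\<integral>x. ln x \<partial>R_law s b \<mu> \<beta> h n)"
  proof (rule integral_mono_AE)
    show "AE x in R_law s b \<mu> \<beta> h n. (- 4 * d / ?r\<^sup>2) * (x\<^sup>2 + (- 2 * ?r * x + ?r\<^sup>2)) + ln (?r / 2) \<le> ln x"
      using R_ge[OF beta, of h n]
    proof eventually_elim
      case (elim x)
      have sq: "x\<^sup>2 + (- 2 * ?r * x + ?r\<^sup>2) = (x - ?r)\<^sup>2" by (simp add: power2_eq_square algebra_simps)
      have x: "0 < x" using elim k by linarith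
      show ?case
      proof (cases "x \<ge> ?r / 2")
        case True
        then have "ln (?r / 2) \<le> ln x" using m by (intro ln_mono) auto
        moreover have "(- 4 * d / ?r\<^sup>2) * (x - ?r)\<^sup>2 \<le> 0" using d by (auto intro!: mult_nonpos_nonneg divide_nonpos_nonneg)
        ultimately show ?thesis unfolding sq by linarith
      next
        case False
        then have "(?r / 2)\<^sup>2 \<le> (?r - x)\<^sup>2" using m by (intro power_mono) auto
        then have "?r\<^sup>2 \<le> 4 * (x - ?r)\<^sup>2" by (simp add: power_divide power2_commute)
        then have "1 \<le> 4 * (x - ?r)\<^sup>2 / ?r\<^sup>2" using m by simp
        then have "d * 1 \<le> d * (4 * (x - ?r)\<^sup>2 / ?r\<^sup>2)" using d by (intro mult_left_mono) auto
        moreover have "ln ((b - 1) / b) \<le> ln x" using elim k by (intro ln_mono) auto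
        moreover have "(- 4 * d / ?r\<^sup>2) * (x - ?r)\<^sup>2 = - (d * (4 * (x - ?r)\<^sup>2 / ?r\<^sup>2))" by simp
        moreover have "ln (?r / 2) = d + ln ((b - 1) / b)" by (simp add: d_def)
        ultimately show ?thesis unfolding sq by linarith
      qed
    qed
  qed (use q R_ln_integrable[OF beta] in \<open>auto simp: has_bochner_integral_iff\<close>)
  also have "(\<integral>x. (- 4 * d / ?r\<^sup>2) * (x\<^sup>2 + (- 2 * ?r * x + ?r\<^sup>2)) + ln (?r / 2) \<partial>R_law s b \<mu> \<beta> h n)
     = (- 4 * d / ?r\<^sup>2) * (?r\<^sup>2 * (1 + relvar \<beta> h n) + (- 2 * ?r * ?r + ?r\<^sup>2)) + ln (?r / 2)"
    using q by (simp only: has_bochner_integral_iff)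
  also have "?r\<^sup>2 * (1 + relvar \<beta> h n) + (- 2 * ?r * ?r + ?r\<^sup>2) = ?r\<^sup>2 * relvar \<beta> h n"
    by (simp add: power2_eq_square algebra_simps)
  also have "(- 4 * d / ?r\<^sup>2) * (?r\<^sup>2 * relvar \<beta> h n) = - 4 * d * relvar \<beta> h n"
    using m by simp
  finally show ?thesis unfolding d_def by (simp add: algebra_simps)
qed

lemma annealed_ge_1: "h \<ge> 0 \<Longrightarrow> annealed h n \<ge> 1"
proof (induction n)
  case (Suc n)
  then have "1 \<le> annealed h n ^ s * exp h ^ (s - 1)"
    by (metis mult_mono' one_le_exp_iff one_le_power mult.left_neutral zero_le_one)
  then show ?case using b1 by (simp add: annealed.simps(2))
qed simp

lemma annealed_Suc_minus_1:
  "b * (annealed h (Suc n) - 1) = annealed h n ^ s * exp h ^ (s - 1) - 1"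
proof -
  have "b * annealed h (Suc n) = annealed h n ^ s * exp h ^ (s - 1) + b - 1"
    using b1 by (simp add: annealed.simps(2))
  then show ?thesis by (simp only: right_diff_distrib)
qed

text \<open>The share of the random product is exactly \<open>1 / b\<close> when the annealed mean
  is 1, and its growth beyond that is controlled by the excess of the mean over 1. As the excess
  grows at least geometrically, the accumulated correction is governed by its last value.\<close>

lemma relvar_nonneg_le:
  assumes beta: "\<beta> > 0" and h: "h \<ge> 0"
  shows "0 \<le> relvar \<beta> h n"
    and "b\<^sup>2 * relvar \<beta> h (Suc n) \<le> exp (2 * (b - 1) * (annealed h (Suc n) - 1)) *
      ((1 + relvar \<beta> h n) ^ s * rel_second_moment \<beta> ^ (s - 1) - 1)"
proof -
  have rho: "rel_second_moment \<beta> \<ge> 1"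
  proof -
    interpret A: prob_space "A_law \<mu> \<beta> 0" by (rule pos_lawD(1)[OF A_pos_law[OF beta]])
    have "has_bochner_integral (A_law \<mu> \<beta> 0) (\<lambda>x. x\<^sup>2 + (- 2 * x + 1)) ((exp 0)\<^sup>2 * (mgf \<mu> (2 * \<beta>) / (mgf \<mu> \<beta>)\<^sup>2) + (- 2 * exp 0 + 1))"
      by (intro has_bochner_integral_add A.has_bochner_integral_affine A_second_moment A_mean beta)
    then have "(\<integral>x. x\<^sup>2 + (- 2 * x + 1) \<partial>A_law \<mu> \<beta> 0) = rel_second_moment \<beta> - 1"
      by (simp add: has_bochner_integral_iff rel_second_moment_def)
    moreover have "(\<integral>x. x\<^sup>2 + (- 2 * x + 1) \<partial>A_law \<mu> \<beta> 0) \<ge> 0"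
    proof (rule integral_nonneg_AE, rule AE_I2)
      fix x :: real
      have "x\<^sup>2 + (- 2 * x + 1) = (x - 1)\<^sup>2" by (simp add: power2_eq_square algebra_simps)
      then show "0 \<le> x\<^sup>2 + (- 2 * x + 1)" by simp
    qed
    ultimately show ?thesis by linarith
  qed
  have F: "0 \<le> (1 + w) ^ s * rel_second_moment \<beta> ^ (s - 1) - 1" if "w \<ge> 0" for w :: real
    using mult_mono[of 1 "(1 + w) ^ s" 1 "rel_second_moment \<beta> ^ (s - 1)"] that rho by simp
  show w: "0 \<le> relvar \<beta> h n" for n by (induction n) (auto intro!: mult_nonneg_nonneg F simp del: One_nat_def)
  let ?m = "annealed h (Suc n)"
  have m: "?m \<ge> 1" by (rule annealed_ge_1[OF h])
  have "b * (1 - (b - 1) / (b * ?m)) = 1 + (b - 1) * (1 - 1 / ?m)"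
    using b1 m by (simp add: field_simps)
  also have "\<dots> \<le> 1 + (b - 1) * (?m - 1)"
  proof -
    have "1 - 1 / y \<le> y - 1" if "y \<ge> 1" for y :: real
      using mult_right_mono[of "1 / y" 1 "y - 1"] that by (simp add: right_diff_distrib)
    from this[OF m] have "1 - 1 / ?m \<le> ?m - 1" .
    then show ?thesis using b1 by (intro add_left_mono mult_left_mono) auto
  qed
  also have "\<dots> \<le> exp ((b - 1) * (?m - 1))" by (rule exp_ge_add_one_self)
  finally have le: "b * (1 - (b - 1) / (b * ?m)) \<le> exp ((b - 1) * (?m - 1))" .
  have "(b - 1) / (b * ?m) \<le> 1" 
  proof -
    have "b * 1 \<le> b * ?m" using m b1 by (intro mult_left_mono) auto
    then have "b - 1 \<le> b * ?m" "0 < b * ?m" using b1 by linarith+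
    then show ?thesis by simp
  qed
  then have "(b * (1 - (b - 1) / (b * ?m)))\<^sup>2 \<le> (exp ((b - 1) * (?m - 1)))\<^sup>2"
    using le b1 by (intro power_mono) auto
  then have "b\<^sup>2 * (1 - (b - 1) / (b * ?m))\<^sup>2 \<le> exp (2 * (b - 1) * (?m - 1))"
    by (simp only: power_mult_distrib exp_double[symmetric] mult.assoc)
  from mult_right_mono[OF this F[OF w[of n]]]
  show "b\<^sup>2 * relvar \<beta> h (Suc n) \<le> exp (2 * (b - 1) * (?m - 1)) *
      ((1 + relvar \<beta> h n) ^ s * rel_second_moment \<beta> ^ (s - 1) - 1)"
    by (simp only: relvar.simps mult.assoc)
qed

end

locale marginal_pinning = pinning +
  assumes b_sq: "b\<^sup>2 = real s"
begin

section \<open>The marginal case: upper bound on the critical point\<close>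

lemma annealed_growth:
  assumes h: "h \<ge> 0"
  shows "b * (annealed h n - 1) \<le> annealed h (Suc n) - 1"
proof -
  let ?x = "annealed h n - 1"
  have "1 + real s * ?x \<le> (1 + ?x) ^ s"
    using annealed_ge_1[OF h, of n] by (intro Bernoulli_inequality) auto
  also have "\<dots> \<le> (1 + ?x) ^ s * exp h ^ (s - 1)"
    using annealed_ge_1[OF h, of n] h mult_left_mono[of 1 "exp h ^ (s - 1)" "(1 + ?x) ^ s"]
    by (simp add: one_le_power)
  finally have "1 + b\<^sup>2 * ?x \<le> annealed h n ^ s * exp h ^ (s - 1)" by (simp add: b_sq)
  then have "b * (b * ?x) \<le> b * (annealed h (Suc n) - 1)"
    unfolding annealed_Suc_minus_1 by (simp add: power2_eq_square mult.assoc)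
  then show ?thesis by (rule mult_left_le_imp_le) (use b1 in simp)
qed

lemma annealed_lower:
  assumes h: "h \<ge> 0"
  shows "b ^ n * h \<le> b * (annealed h (Suc n) - 1)"
proof (induction n)
  case 0
  have "1 + h \<le> exp h" by (rule exp_ge_add_one_self)
  also have "\<dots> \<le> exp h ^ (s - 1)" using s2 h by (intro self_le_power) auto
  finally show ?case unfolding annealed_Suc_minus_1 by simp
next
  case (Suc n)
  have "b ^ Suc n * h \<le> b * (b * (annealed h (Suc n) - 1))" using mult_left_mono[OF Suc, of b] b1 by (simp add: mult.assoc)
  also have "\<dots> \<le> b * (annealed h (Suc (Suc n)) - 1)"
    using annealed_growth[OF h, of "Suc n"] b1 by (intro mult_left_mono) auto
  finally show ?case .
qed

text \<open>Here marginality enters: the linear term \<open>s * w\<close> matches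
  \<open>b\<^sup>2 * w\<close> exactly. Restricting to \<open>w \<le> \<beta>\<close> makes the
  quadratic error \<open>w\<^sup>2\<close> no larger than the order \<open>\<beta>\<^sup>2\<close>
  of the fresh noise, so that one additive constant covers both.\<close>

lemma one_step_variance_bound:
  obtains D where "D > 0"
    "\<And>\<beta> w. 0 < \<beta> \<Longrightarrow> \<beta> \<le> 1 \<Longrightarrow> 0 \<le> w \<Longrightarrow> w \<le> \<beta> \<Longrightarrow>
      (1 + w) ^ s * rel_second_moment \<beta> ^ (s - 1) - 1 \<le> b\<^sup>2 * (w + D * \<beta>\<^sup>2)"
proof
  define \<Gamma> where "\<Gamma> = 4 * (1 + mgf \<mu> 3)"
  define B where "B = (1 + \<Gamma>) ^ s"
  define D' where "D' = 3 ^ s + B * (1 + real s + 3 ^ s)"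
  have G: "\<Gamma> \<ge> 0" using mgf_ge_1[of 3] by (simp add: \<Gamma>_def)
  then have B: "B \<ge> 1" by (simp add: B_def)
  have D': "D' > 0" using B unfolding D'_def by (intro add_pos_nonneg) auto
  then show "D' / real s > 0" using s2 by simp
  fix \<beta> w :: real assume beta: "0 < \<beta>" "\<beta> \<le> 1" and w: "0 \<le> w" "w \<le> \<beta>"
  have w1: "w \<le> 1" "w\<^sup>2 \<le> \<beta>\<^sup>2" "w\<^sup>2 \<le> 1" "\<beta>\<^sup>2 \<le> 1" using w beta by (auto intro!: power_mono power_le_one)
  have pos: "rel_second_moment \<beta> \<ge> 0"
    using mgf_ge_1[of "2 * \<beta>"] beta by (auto simp: rel_second_moment_def)
  have "rel_second_moment \<beta> \<le> mgf \<mu> (2 * \<beta>) / 1"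
    unfolding rel_second_moment_def using mgf_ge_1[of \<beta>] mgf_ge_1[of "2 * \<beta>"] beta
    by (intro divide_left_mono) (auto intro: one_le_power)
  also have "\<dots> \<le> 1 + \<beta>\<^sup>2 * \<Gamma>"
    using mgf_le[of "2 * \<beta>"] beta by (simp add: \<Gamma>_def power_mult_distrib algebra_simps)
  finally have "rel_second_moment \<beta> \<le> 1 + \<beta>\<^sup>2 * \<Gamma>" .
  then have "rel_second_moment \<beta> ^ (s - 1) \<le> (1 + \<beta>\<^sup>2 * \<Gamma>) ^ (s - 1)" using pos by (rule power_mono)
  also have "\<dots> \<le> (1 + \<beta>\<^sup>2 * \<Gamma>) ^ s" using G by (intro power_increasing) auto
  also have "\<dots> \<le> 1 + \<beta>\<^sup>2 * (B - 1)"
    unfolding B_def using G w1 by (intro power_one_plus_scaled_le) auto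
  also have "\<dots> \<le> 1 + \<beta>\<^sup>2 * B" by (intro add_left_mono mult_left_mono) auto
  finally have 1: "rel_second_moment \<beta> ^ (s - 1) \<le> 1 + \<beta>\<^sup>2 * B" .
  have 2: "(1 + w) ^ s \<le> 1 + real s * w + 3 ^ s * w\<^sup>2" using w w1 by (intro power_one_plus_le_quadratic)
  have "(1 + w) ^ s * rel_second_moment \<beta> ^ (s - 1) \<le> (1 + real s * w + 3 ^ s * w\<^sup>2) * (1 + \<beta>\<^sup>2 * B)"
    using 1 2 pos B w by (intro mult_mono) (auto intro!: add_nonneg_nonneg)
  also have "\<dots> = 1 + real s * w + 3 ^ s * w\<^sup>2 + \<beta>\<^sup>2 * (B * (1 + real s * w + 3 ^ s * w\<^sup>2))"
    by (simp add: algebra_simps)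
  also have "\<dots> \<le> 1 + real s * w + 3 ^ s * \<beta>\<^sup>2 + \<beta>\<^sup>2 * (B * (1 + real s * 1 + 3 ^ s * 1))"
    using w w1 B by (intro add_mono mult_left_mono) auto
  also have "\<dots> = 1 + real s * w + D' * \<beta>\<^sup>2" by (simp add: D'_def algebra_simps)
  finally show "(1 + w) ^ s * rel_second_moment \<beta> ^ (s - 1) - 1 \<le> b\<^sup>2 * (w + D' / real s * \<beta>\<^sup>2)"
    using s2 by (simp add: b_sq distrib_left)
qed

text \<open>The majorant \<open>?W\<close> is linear accumulation of noise times
  \<open>exp (2 * b * x)\<close> with \<open>x\<close> the excess of the annealed mean. The exponent
  \<open>2 * b\<close> is self-reproducing: from \<open>b * x \<le> y\<close> follows
  \<open>2 * (b - 1) * y + 2 * b * x \<le> 2 * b * y\<close>, where \<open>y\<close> is the next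
  excess. The condition \<open>small\<close> keeps \<open>?W \<le> \<beta>\<close>, hence
  \<open>step\<close> applicable, up to level \<open>n\<close>.\<close>

lemma relvar_bound:
  assumes step: "\<And>w. 0 \<le> w \<Longrightarrow> w \<le> \<beta> \<Longrightarrow>
      (1 + w) ^ s * rel_second_moment \<beta> ^ (s - 1) - 1 \<le> b\<^sup>2 * (w + D * \<beta>\<^sup>2)"
    and beta: "\<beta> > 0" and h: "h \<ge> 0" and D: "D > 0"
    and small: "real n * D * \<beta> * exp (2 * b * (annealed h n - 1)) \<le> 1"
  shows "relvar \<beta> h n \<le> \<beta>"
proof -
  let ?x = "\<lambda>k. annealed h k - 1"
  let ?W = "\<lambda>k. real k * D * \<beta>\<^sup>2 * exp (2 * b * ?x k)"
  have x_mono: "?x k \<le> ?x n" if "k \<le> n" for k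
  proof -
    have "?x m \<le> ?x (Suc m)" for m
      using annealed_growth[OF h, of m] annealed_ge_1[OF h, of m] b1 mult_right_mono[of 1 b "?x m"]
      by simp
    from lift_Suc_mono_le[of ?x, OF this that] show ?thesis .
  qed
  have W_le: "?W k \<le> \<beta>" if "k \<le> n" for k
  proof -
    have "?W k \<le> real n * D * \<beta>\<^sup>2 * exp (2 * b * ?x n)"
      using that D x_mono[OF that] b1 by (intro mult_mono) auto
    also have "\<dots> = \<beta> * (real n * D * \<beta> * exp (2 * b * ?x n))" by (simp add: power2_eq_square)
    also have "\<dots> \<le> \<beta> * 1" using small beta by (intro mult_left_mono) auto
    finally show ?thesis by simp
  qed
  have "relvar \<beta> h k \<le> ?W k" if "k \<le> n" for k
    using that
  proof (induction k)
    case (Suc k)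
    then have IH: "relvar \<beta> h k \<le> ?W k" and kn: "k \<le> n" by auto
    note w = relvar_nonneg_le[OF beta h, of k]
    have "(1 + relvar \<beta> h k) ^ s * rel_second_moment \<beta> ^ (s - 1) - 1 \<le> b\<^sup>2 * (relvar \<beta> h k + D * \<beta>\<^sup>2)"
      using w(1) IH W_le[OF kn] by (intro step) auto
    then have "b\<^sup>2 * relvar \<beta> h (Suc k) \<le> exp (2 * (b - 1) * ?x (Suc k)) * (b\<^sup>2 * (relvar \<beta> h k + D * \<beta>\<^sup>2))"
      by (intro order_trans[OF w(2)] mult_left_mono) auto
    then have "b\<^sup>2 * relvar \<beta> h (Suc k) \<le> b\<^sup>2 * (exp (2 * (b - 1) * ?x (Suc k)) * (relvar \<beta> h k + D * \<beta>\<^sup>2))"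
      by (simp only: mult.left_commute)
    then have "relvar \<beta> h (Suc k) \<le> exp (2 * (b - 1) * ?x (Suc k)) * (relvar \<beta> h k + D * \<beta>\<^sup>2)"
      by (rule mult_left_le_imp_le) (use b1 in simp)
    also have "\<dots> \<le> exp (2 * (b - 1) * ?x (Suc k)) * (?W k + D * \<beta>\<^sup>2 * exp (2 * b * ?x k))"
    proof (intro mult_left_mono add_mono IH)
      have "1 \<le> exp (2 * b * ?x k)" using annealed_ge_1[OF h, of k] b1 by simp
      from mult_left_mono[OF this, of "D * \<beta>\<^sup>2"] show "D * \<beta>\<^sup>2 \<le> D * \<beta>\<^sup>2 * exp (2 * b * ?x k)" using D by simp
    qed auto
    also have "\<dots> = real (Suc k) * D * \<beta>\<^sup>2 * (exp (2 * (b - 1) * ?x (Suc k)) * exp (2 * b * ?x k))"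
      by (simp only: of_nat_Suc distrib_left distrib_right mult_1_left mult_1_right mult.assoc mult.left_commute mult.commute)
    also have "exp (2 * (b - 1) * ?x (Suc k)) * exp (2 * b * ?x k) = exp (2 * (b - 1) * ?x (Suc k) + 2 * b * ?x k)"
      by (simp only: exp_add)
    also have "real (Suc k) * D * \<beta>\<^sup>2 * \<dots> \<le> ?W (Suc k)"
    proof (rule mult_left_mono)
      have aux: "2 * (b - 1) * y + 2 * b * x \<le> 2 * b * y" if "b * x \<le> y" for x y :: real
        using that by (simp add: algebra_simps)
      show "exp (2 * (b - 1) * ?x (Suc k) + 2 * b * ?x k) \<le> exp (2 * b * ?x (Suc k))"
        unfolding exp_le_cancel_iff by (rule aux[OF annealed_growth[OF h]])
    qed (use D in auto)
    finally show ?case .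
  qed simp
  from order_trans[OF this[of n] W_le[of n]] show ?thesis by simp
qed

lemma free_energy_pos_exp:
  "\<exists>c2 \<beta>0. c2 > 0 \<and> \<beta>0 > 0 \<and> (\<forall>\<beta>. 0 < \<beta> \<and> \<beta> \<le> \<beta>0 \<longrightarrow> free_energy s b \<mu> \<beta> (exp (- c2 / \<beta>)) > 0)"
proof -
  obtain D where D: "D > 0"
    "\<And>\<beta> w. 0 < \<beta> \<Longrightarrow> \<beta> \<le> 1 \<Longrightarrow> 0 \<le> w \<Longrightarrow> w \<le> \<beta> \<Longrightarrow>
      (1 + w) ^ s * rel_second_moment \<beta> ^ (s - 1) - 1 \<le> b\<^sup>2 * (w + D * \<beta>\<^sup>2)"
    using one_step_variance_bound by blast
  define lk where "lk = - ln ((b - 1) / b)"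
  have "0 < (b - 1) / b" "(b - 1) / b < 1" using b1 by auto
  then have lk: "lk > 0" by (simp add: lk_def)
  \<comment> \<open>Chosen so that \<open>T / 2 - lk / 2\<close> exceeds
    \<open>1 + mgf \<mu> 3 + ln b\<close>, the worst value of \<open>- log_offset\<close>, by
    \<open>1 / 2\<close>. Then \<open>K = 2 * exp T\<close> gives
    \<open>ln (K / 2) = T\<close>.\<close>
  define T where "T = lk + 2 * (1 + mgf \<mu> 3) + 2 * ln b + 1"
  have M3: "mgf \<mu> 3 \<ge> 1" by (rule mgf_ge_1) simp
  have lnb: "ln b > 0" using b1 by simp
  have T: "T > 0" unfolding T_def using lk M3 lnb by (intro add_pos_pos mult_pos_pos) auto
  define K where "K = 2 * exp T"
  have K: "K \<ge> 2" using T by (simp add: K_def)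
  \<comment> \<open>Bounds the overshoot: at the first passage above \<open>K\<close> the previous
    mean is below \<open>K\<close>, and \<open>h \<le> 1\<close>.\<close>
  define X where "X = K ^ s * exp (real s)"
  define \<epsilon> where "\<epsilon> = 1 / (D * exp (2 * b * X))"
  have eps: "\<epsilon> > 0" using D by (simp add: \<epsilon>_def)
  \<comment> \<open>The passage time satisfies \<open>n * ln b \<le> L + c2 / \<beta>\<close>; for
    \<open>\<beta> * L \<le> c2\<close> this gives \<open>n * \<beta> * ln b \<le> 2 * c2\<close>,
    so half of \<open>\<epsilon> * ln b\<close> is the budget. The value of \<epsilon> is what the
    hypothesis \<open>small\<close> of \<open>relvar_bound\<close> tolerates.\<close>
  define c2 where "c2 = \<epsilon> * ln b / 2"
  have c2: "c2 > 0" using eps lnb by (simp add: c2_def)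
  define L where "L = ln (K * b ^ 3)"
  have Kb: "K * b ^ 3 > 1" using K b1 by (intro less_1_mult) auto
  then have L: "L > 0" by (simp add: L_def)
  define \<beta>0 where "\<beta>0 = min (1 / 8) (c2 / L)"
  have "free_energy s b \<mu> \<beta> (exp (- c2 / \<beta>)) > 0" if beta: "0 < \<beta>" "\<beta> \<le> \<beta>0" for \<beta>
  proof -
    define h where "h = exp (- c2 / \<beta>)"
    have beta8: "\<beta> \<le> 1 / 8" and betaL: "\<beta> * L \<le> c2" using beta L by (auto simp: \<beta>0_def field_simps)
    have h: "h > 0" "h \<le> 1" using c2 beta by (auto simp: h_def divide_nonpos_pos)
    have h0: "h \<ge> 0" using h by simp
    have "\<exists>n. annealed h n \<ge> K"
    proof -
      obtain n where "b * K / h < b ^ n" using real_arch_pow[OF b1] by blast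
      then have "b * K < b ^ n * h" using h by (simp add: divide_simps mult.commute)
      also have "\<dots> \<le> b * (annealed h (Suc n) - 1)" by (rule annealed_lower[OF h0])
      finally have "K < annealed h (Suc n) - 1" using b1 by simp
      then show ?thesis by (intro exI[of _ "Suc n"]) linarith
    qed
    define n where "n = (LEAST n. annealed h n \<ge> K)"
    have nK: "annealed h n \<ge> K" unfolding n_def by (rule LeastI_ex) fact
    have "n \<noteq> 0" using nK K by (intro notI) simp
    then obtain m where m: "n = Suc m" using not0_implies_Suc by blast
    have mK: "annealed h m < K"
      using not_less_Least[of m "\<lambda>n. annealed h n \<ge> K"] m by (simp add: n_def)
    have nX: "annealed h n - 1 \<le> X"
    proof -
      define y where "y = annealed h m ^ s * exp h ^ (s - 1)"
      have "y \<le> K ^ s * exp 1 ^ s"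
      proof -
        have "exp h ^ (s - 1) \<le> exp 1 ^ (s - 1)" using h by (intro power_mono) auto
        also have "\<dots> \<le> exp (1::real) ^ s" by (intro power_increasing) auto
        finally show ?thesis unfolding y_def using mK annealed_pos[of h m]
          by (intro mult_mono power_mono) (auto simp: less_imp_le)
      qed
      then have yX: "y \<le> X" by (simp add: X_def flip: exp_of_nat_mult)
      have "annealed h n = (y + b - 1) / b" by (simp add: m y_def annealed.simps(2))
      also have "\<dots> \<le> y + 1"
      proof -
        have "y \<ge> 0" using annealed_pos[of h m] by (simp add: y_def)
        then have "y \<le> b * y" using b1 by (simp add: mult_le_cancel_right1)
        then show ?thesis using b1 by (simp add: divide_simps algebra_simps)
      qed
      finally show ?thesis using yX by simp
    qed
    have n_le: "real n * ln b \<le> L + c2 / \<beta>"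
    proof -
      \<comment> \<open>The lower bound on growth is used at level \<open>n - 1\<close>, where the
        mean is still below \<open>K\<close>. Its index shift and its factor \<open>b\<close>
        account for \<open>b ^ 3\<close>.\<close>
      have "b ^ n * h \<le> K * b ^ 3"
      proof (cases m)
        case 0
        have "b * h \<le> (K * b\<^sup>2) * b" using h K b1 mult_mono[of h 1 1 "K * b\<^sup>2"] mult_mono[of 1 K 1 "b\<^sup>2"] by (simp add: mult.commute)
        then show ?thesis by (simp add: m 0 power2_eq_square power3_eq_cube mult.assoc)
      next
        case (Suc j)
        have "b ^ j * h \<le> b * (annealed h (Suc j) - 1)" by (rule annealed_lower[OF h0])
        also have "\<dots> \<le> b * K" using mK b1 Suc by (intro mult_left_mono) auto
        finally have "b\<^sup>2 * (b ^ j * h) \<le> b\<^sup>2 * (b * K)" using b1 by (intro mult_left_mono) auto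
        then show ?thesis by (simp add: m Suc power2_eq_square power3_eq_cube mult_ac)
      qed
      then have "ln (b ^ n * h) \<le> L" unfolding L_def using b1 h by (intro ln_mono) auto
      also have "ln (b ^ n * h) = real n * ln b - c2 / \<beta>"
        using b1 h by (simp add: ln_mult ln_realpow) (simp add: h_def)
      finally show ?thesis by simp
    qed
    have "real n * \<beta> * ln b \<le> \<epsilon> * ln b"
    proof -
      have "real n * ln b * \<beta> \<le> (L + c2 / \<beta>) * \<beta>" using n_le beta by (intro mult_right_mono) auto
      also have "\<dots> = \<beta> * L + c2" using beta by (simp add: field_simps)
      also have "\<dots> \<le> \<epsilon> * ln b" using betaL by (simp add: c2_def)
      finally show ?thesis by (simp add: mult_ac)
    qed
    then have nb: "real n * \<beta> \<le> \<epsilon>" using lnb by simp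
    have "real n * D * \<beta> * exp (2 * b * (annealed h n - 1)) \<le> real n * D * \<beta> * exp (2 * b * X)"
      using nX D beta b1 by (intro mult_left_mono) auto
    also have "\<dots> = (D * (real n * \<beta>)) * exp (2 * b * X)" by simp
    also have "\<dots> \<le> (D * \<epsilon>) * exp (2 * b * X)" using nb D by (intro mult_right_mono mult_left_mono) auto
    also have "\<dots> = 1" using D by (simp add: \<epsilon>_def)
    finally have small: "real n * D * \<beta> * exp (2 * b * (annealed h n - 1)) \<le> 1" .
    have w: "relvar \<beta> h n \<le> \<beta>"
      using D beta beta8 h0 small by (intro relvar_bound[of \<beta> D]) auto
    have w0: "relvar \<beta> h n \<ge> 0" using relvar_nonneg_le(1)[OF beta(1) h0] .
    have lnr: "ln (annealed h n / 2) \<ge> T"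
    proof -
      have "ln (exp T) \<le> ln (annealed h n / 2)" using nK by (intro ln_mono) (auto simp: K_def)
      then show ?thesis by simp
    qed
    have "ln (annealed h n / 2) - 4 * relvar \<beta> h n * (ln (annealed h n / 2) + lk) \<ge> T / 2 - lk / 2"
    proof -
      have "4 * relvar \<beta> h n \<le> 1 / 2" using w beta8 by simp
      then have "4 * relvar \<beta> h n * (ln (annealed h n / 2) + lk) \<le> 1 / 2 * (ln (annealed h n / 2) + lk)"
        using lnr T lk by (intro mult_right_mono) auto
      then show ?thesis using lnr by (simp add: field_simps)
    qed
    then have ge: "(\<integral>x. ln x \<partial>R_law s b \<mu> \<beta> h n) \<ge> T / 2 - lk / 2"
      using R_ln_ge[OF beta(1), of h n] nK K by (simp add: lk_def)
    have "ln (mgf \<mu> \<beta>) \<le> mgf \<mu> \<beta> - 1" using mgf_ge_1[OF beta(1)] by (intro ln_le_minus_one) auto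
    also have "\<dots> \<le> \<beta>\<^sup>2 * (1 + mgf \<mu> 3)" using mgf_le[of \<beta>] beta beta8 by simp
    also have "\<dots> \<le> 1 * (1 + mgf \<mu> 3)" using beta beta8 M3 by (intro mult_right_mono power_le_one) auto
    finally have lnM: "ln (mgf \<mu> \<beta>) \<le> 1 + mgf \<mu> 3" by simp
    have "ln b / real (s - 1) \<le> ln b / 1" using s2 lnb by (intro divide_left_mono) auto
    then have "log_offset \<beta> h \<ge> - (1 + mgf \<mu> 3) - ln b"
      unfolding log_offset_def[OF beta(1)] using lnM h by simp
    then have "(\<integral>x. ln x \<partial>R_law s b \<mu> \<beta> h n) + log_offset \<beta> h > 0"
      using ge unfolding T_def by (simp add: field_simps)
    then show ?thesis unfolding h_def[symmetric] by (rule free_energy_pos_if[OF beta(1)])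
  qed
  moreover have "\<beta>0 > 0" using c2 L by (simp add: \<beta>0_def)
  ultimately show ?thesis using c2 by blast
qed

end

section \<open>Fractional moments and the lower bound\<close>

text \<open>The affine weights \<open>c + d x\<close> make this bound stable under both products of
  independent variables and the affine step of the recursion.\<close>

definition frac_dominated :: "real \<Rightarrow> real \<Rightarrow> real \<Rightarrow> real measure \<Rightarrow> bool" where
  "frac_dominated \<theta> K m M \<longleftrightarrow> (\<forall>c\<ge>0. \<forall>d\<ge>0.
     (\<integral>\<^sup>+x. ennreal ((c + d * x) powr \<theta>) \<partial>M) \<le> ennreal (K * (c + d * m) powr \<theta>))"

lemma frac_dominatedD:
  assumes "frac_dominated \<theta> K m M" "c \<ge> 0" "d \<ge> 0"
  shows "(\<integral>\<^sup>+x. ennreal ((c + d * x) powr \<theta>) \<partial>M) \<le> ennreal (K * (c + d * m) powr \<theta>)"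
  using assms unfolding frac_dominated_def by blast

lemma frac_dominated_mono:
  assumes "frac_dominated \<theta> K m M" "0 \<le> K" "K \<le> K'" "0 \<le> m" "m \<le> m'" "0 \<le> \<theta>"
  shows "frac_dominated \<theta> K' m' M"
  unfolding frac_dominated_def
proof (intro allI impI)
  fix c d :: real assume cd: "0 \<le> c" "0 \<le> d"
  have "K * (c + d * m) powr \<theta> \<le> K' * (c + d * m') powr \<theta>"
    using assms cd by (intro mult_mono powr_mono2 add_left_mono mult_left_mono) auto
  then show "(\<integral>\<^sup>+x. ennreal ((c + d * x) powr \<theta>) \<partial>M) \<le> ennreal (K' * (c + d * m') powr \<theta>)"
    using frac_dominatedD[OF assms(1) cd] by (meson ennreal_leI order_trans)
qed

lemma frac_dominated_return: "frac_dominated \<theta> 1 1 (return borel 1)"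
  by (simp add: frac_dominated_def nn_integral_return)

text \<open>For fixed \<open>x\<close>, the weight \<open>c + (d * x) * y\<close> is affine in
  \<open>y\<close>; integrating \<open>y\<close> out replaces it by \<open>m2\<close>, and what
  remains is again affine in \<open>x\<close>. Thus costs and means both multiply.\<close>

lemma frac_dominated_mult_conv:
  assumes M: "pos_law M" and N: "pos_law N"
    and f: "frac_dominated \<theta> K1 m1 M" "frac_dominated \<theta> K2 m2 N"
    and nonneg: "K2 \<ge> 0" "m2 \<ge> 0"
  shows "frac_dominated \<theta> (K1 * K2) (m1 * m2) (mult_conv M N)"
  unfolding frac_dominated_def
proof (intro allI impI)
  fix c d :: real assume cd: "0 \<le> c" "0 \<le> d"
  note [measurable_cong] = pos_lawD(2)[OF M] pos_lawD(2)[OF N]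
  interpret M: prob_space M by (rule pos_lawD(1)[OF M])
  interpret N: prob_space N by (rule pos_lawD(1)[OF N])
  have "(\<integral>\<^sup>+x. ennreal ((c + d * x) powr \<theta>) \<partial>mult_conv M N)
      = (\<integral>\<^sup>+z. ennreal ((c + d * (fst z * snd z)) powr \<theta>) \<partial>(M \<Otimes>\<^sub>M N))"
    unfolding mult_conv_def by (subst nn_integral_distr) (auto simp: case_prod_beta)
  also have "\<dots> = (\<integral>\<^sup>+x. \<integral>\<^sup>+y. ennreal ((c + (d * x) * y) powr \<theta>) \<partial>N \<partial>M)"
    by (subst N.nn_integral_fst[symmetric]) (auto simp: mult.assoc)
  also have "\<dots> \<le> (\<integral>\<^sup>+x. ennreal K2 * ennreal ((c + (d * m2) * x) powr \<theta>) \<partial>M)"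
  proof (rule nn_integral_mono_AE)
    show "AE x in M. (\<integral>\<^sup>+y. ennreal ((c + (d * x) * y) powr \<theta>) \<partial>N) \<le> ennreal K2 * ennreal ((c + (d * m2) * x) powr \<theta>)"
      using pos_lawD(4)[OF M]
    proof eventually_elim
      case (elim x)
      then show ?case using frac_dominatedD[OF f(2) cd(1), of "d * x"] cd nonneg
        by (simp add: ennreal_mult[symmetric] mult_ac)
    qed
  qed
  also have "\<dots> = ennreal K2 * (\<integral>\<^sup>+x. ennreal ((c + (d * m2) * x) powr \<theta>) \<partial>M)"
    by (rule nn_integral_cmult) measurable
  also have "\<dots> \<le> ennreal K2 * ennreal (K1 * (c + (d * m2) * m1) powr \<theta>)"
    using cd nonneg by (intro mult_left_mono frac_dominatedD[OF f(1)]) auto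
  also have "\<dots> = ennreal (K1 * K2 * (c + d * (m1 * m2)) powr \<theta>)"
    using nonneg by (simp add: ennreal_mult'[symmetric] mult_ac)
  finally show "(\<integral>\<^sup>+x. ennreal ((c + d * x) powr \<theta>) \<partial>mult_conv M N) \<le> ennreal (K1 * K2 * (c + d * (m1 * m2)) powr \<theta>)" .
qed

lemma frac_dominated_mult_conv_pow:
  assumes M: "pos_law M" and f: "frac_dominated \<theta> K m M" and nonneg: "K \<ge> 0" "m \<ge> 0"
  shows "frac_dominated \<theta> (K ^ n) (m ^ n) (mult_conv_pow M n)"
proof (induction n)
  case (Suc n)
  show ?case
    using frac_dominated_mult_conv[OF M pos_law_mult_conv_pow[OF M] f Suc] nonneg by simp
qed (simp add: frac_dominated_return)

lemma frac_dominated_affine: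
  assumes M: "sets M = sets borel" and f: "frac_dominated \<theta> K m M" and b: "b > 1"
  shows "frac_dominated \<theta> K ((m + b - 1) / b) (affine_law b M)"
  unfolding frac_dominated_def
proof (intro allI impI)
  fix c d :: real assume cd: "0 \<le> c" "0 \<le> d"
  note [measurable_cong] = M
  have eq: "c + d * ((x + b - 1) / b) = (c + d * (b - 1) / b) + (d / b) * x" for x
    using b by (simp add: field_simps)
  have "(\<integral>\<^sup>+x. ennreal ((c + d * x) powr \<theta>) \<partial>affine_law b M)
     = (\<integral>\<^sup>+x. ennreal (((c + d * (b - 1) / b) + (d / b) * x) powr \<theta>) \<partial>M)"
    unfolding affine_law_def eq[symmetric] by (subst nn_integral_distr) auto
  also have "\<dots> \<le> ennreal (K * ((c + d * (b - 1) / b) + (d / b) * m) powr \<theta>)"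
    using cd b by (intro frac_dominatedD[OF f]) auto
  finally show "(\<integral>\<^sup>+x. ennreal ((c + d * x) powr \<theta>) \<partial>affine_law b M) \<le> ennreal (K * (c + d * ((m + b - 1) / b)) powr \<theta>)"
    unfolding eq .
qed

text \<open>Young's inequality replaces the Hoelder inequality of the usual change-of-measure
  argument; \<open>g\<close> is the density of the tilted law.\<close>

lemma (in prob_space) frac_dominated_tilt:
  fixes X g :: "'a \<Rightarrow> real" and p :: nat
  assumes p: "\<theta> = real p / (real p + 1)"
    and [measurable]: "X \<in> borel_measurable M"
    and X: "\<And>w. X w > 0" and g: "\<And>w. g w > 0"
    and int_g: "has_bochner_integral M g 1"
    and int_gX: "has_bochner_integral M (\<lambda>w. g w * X w) m"
    and int_p: "has_bochner_integral M (\<lambda>w. inverse (g w) ^ p) C"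
    and m: "m > 0" and C: "C \<ge> 0"
  shows "frac_dominated \<theta> (\<theta> + (1 - \<theta>) * C) m (distr M borel X)"
  unfolding frac_dominated_def
proof (intro allI impI)
  fix c d :: real assume cd: "0 \<le> c" "0 \<le> d"
  \<comment> \<open>The identity \<open>p * (1 - \<theta>) = \<theta>\<close> is the reason for the
    parametrisation by a natural number: the negative moment of the density paired with \<theta> is
    then an integer power.\<close>
  have th: "0 \<le> \<theta>" "\<theta> < 1" "real p * (1 - \<theta>) = \<theta>" unfolding p by (auto simp: field_simps)
  show "(\<integral>\<^sup>+x. ennreal ((c + d * x) powr \<theta>) \<partial>distr M borel X) \<le> ennreal ((\<theta> + (1 - \<theta>) * C) * (c + d * m) powr \<theta>)"
  proof (cases "c = 0 \<and> d = 0")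
    case False
    \<comment> \<open>Normalisation making the tilted mean of \<open>(c + d * X) / T\<close> equal
      to 1, so that the first term of Young's inequality integrates to \<theta>.\<close>
    define T where "T = c + d * m"
    have T: "T > 0" using False cd m unfolding T_def
      by (metis add_nonneg_pos add_pos_nonneg less_eq_real_def mult_nonneg_nonneg mult_pos_pos)
    let ?F = "\<lambda>w. T powr \<theta> * (\<theta> / T * (c * g w + d * (g w * X w)) + (1 - \<theta>) * inverse (g w) ^ p)"
    have Fint: "has_bochner_integral M ?F (T powr \<theta> * (\<theta> / T * (c * 1 + d * m) + (1 - \<theta>) * C))"
      by (intro has_bochner_integral_mult_right has_bochner_integral_add int_g int_gX int_p)
    have Fval: "T powr \<theta> * (\<theta> / T * (c * 1 + d * m) + (1 - \<theta>) * C) = (\<theta> + (1 - \<theta>) * C) * T powr \<theta>"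
      using T by (simp add: T_def[symmetric])
    have F0: "?F w \<ge> 0" for w
      using th cd T X[of w] g[of w]
      by (intro mult_nonneg_nonneg add_nonneg_nonneg divide_nonneg_pos) (auto intro: less_imp_le)
    have le: "(c + d * X w) powr \<theta> \<le> ?F w" for w
    proof -
      define t where "t = c + d * X w"
      have t: "t > 0" using False cd X[of w] unfolding t_def
        by (metis add_nonneg_pos add_pos_nonneg less_eq_real_def mult_nonneg_nonneg mult_pos_pos)
      \<comment> \<open>The two factors are chosen so that the powers of \<open>g\<close> cancel in
        their product, leaving the untilted \<open>(t / T) powr \<theta>\<close>.\<close>
      have "(g w * t / T) powr \<theta> * (inverse (g w) ^ p) powr (1 - \<theta>) \<le> \<theta> * (g w * t / T) + (1 - \<theta>) * inverse (g w) ^ p"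
        using th g[of w] t T by (intro Youngs_inequality_0) auto
      also have "(inverse (g w) ^ p) powr (1 - \<theta>) = inverse (g w) powr \<theta>"
        using g[of w] th(3) by (simp add: powr_realpow[symmetric] powr_powr)
      also have "(g w * t / T) powr \<theta> * inverse (g w) powr \<theta> = (t / T) powr \<theta>"
      proof -
        have "g w * t / T * inverse (g w) = t / T" using g[of w] by (simp add: field_simps)
        moreover have "(g w * t / T) powr \<theta> * inverse (g w) powr \<theta> = (g w * t / T * inverse (g w)) powr \<theta>"
          using g[of w] t T by (intro powr_mult[symmetric])
        ultimately show ?thesis by (simp only:)
      qed
      finally have "(t / T) powr \<theta> \<le> \<theta> * (g w * t / T) + (1 - \<theta>) * inverse (g w) ^ p" .
      then have "T powr \<theta> * (t / T) powr \<theta> \<le> T powr \<theta> * (\<theta> * (g w * t / T) + (1 - \<theta>) * inverse (g w) ^ p)"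
        by (intro mult_left_mono) auto
      also have "T powr \<theta> * (t / T) powr \<theta> = t powr \<theta>" using t T by (simp add: powr_divide)
      also have "\<theta> * (g w * t / T) = \<theta> / T * (c * g w + d * (g w * X w))" by (simp add: t_def algebra_simps add_divide_distrib)
      finally show ?thesis by (simp add: t_def)
    qed
    have "(\<integral>\<^sup>+x. ennreal ((c + d * x) powr \<theta>) \<partial>distr M borel X) = (\<integral>\<^sup>+w. ennreal ((c + d * X w) powr \<theta>) \<partial>M)"
      by (rule nn_integral_distr) measurable
    also have "\<dots> \<le> (\<integral>\<^sup>+w. ennreal (?F w) \<partial>M)"
      by (intro nn_integral_mono ennreal_leI le)
    also have "\<dots> = ennreal ((\<theta> + (1 - \<theta>) * C) * T powr \<theta>)"
      using Fint F0 unfolding Fval by (subst nn_integral_eq_integral) (auto simp: has_bochner_integral_iff mult.commute)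
    finally show ?thesis by (simp add: T_def)
  qed simp
qed

text \<open>For \<open>x = \<delta> * f\<close> with \<open>f\<close> centred, the linear term
  integrates to 0. The negative moment of the tilt therefore costs only order
  \<open>\<delta>\<^sup>2\<close>.\<close>

lemma inverse_power_le_quadratic:
  "\<exists>C\<ge>0. \<forall>x::real. \<bar>x\<bar> \<le> 1 / 2 \<longrightarrow> inverse (1 + x) ^ p \<le> 1 - real p * x + C * x\<^sup>2"
proof (induction p)
  case (Suc p)
  then obtain C where C: "C \<ge> 0" "\<And>x::real. \<bar>x\<bar> \<le> 1 / 2 \<Longrightarrow> inverse (1 + x) ^ p \<le> 1 - real p * x + C * x\<^sup>2"
    by blast
  have "inverse (1 + x) ^ Suc p \<le> 1 - real (Suc p) * x + (2 * C + 2 * real (Suc p)) * x\<^sup>2" if x: "\<bar>x\<bar> \<le> 1 / 2" for x :: real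
  proof -
    have pos: "1 + x \<ge> 1 / 2" using x by linarith
    have i2: "inverse (1 + x) \<le> 2" using pos by (simp add: field_simps)
    have "inverse (1 + x) ^ Suc p \<le> inverse (1 + x) * (1 - real p * x + C * x\<^sup>2)"
      unfolding power_Suc using C(2)[OF x] pos by (intro mult_left_mono) auto
    also have "\<dots> = 1 - real (Suc p) * x + (real (Suc p) + C) * x\<^sup>2 * inverse (1 + x)"
    proof -
      define i where "i = inverse (1 + x)"
      have "x * i = 1 - i" using pos by (simp add: i_def field_simps)
      then have "i * (1 - real p * x + C * x\<^sup>2) = 1 - (real p + 1) * x + (real p + 1 + C) * x\<^sup>2 * i" by algebra
      then show ?thesis by (simp add: i_def add.commute)
    qed
    also have "\<dots> \<le> 1 - real (Suc p) * x + (real (Suc p) + C) * x\<^sup>2 * 2"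
      using i2 C(1) by (intro add_left_mono mult_left_mono) auto
    finally show ?thesis by (simp add: algebra_simps)
  qed
  then show ?case using C(1) by (intro exI[of _ "2 * C + 2 * real (Suc p)"]) auto
qed (auto intro!: exI[of _ 0])

section \<open>Tilting a single disorder variable\<close>

context pinning
begin

lemma not_AE_zero: "\<not> (AE w in \<mu>. w = 0)"
proof
  assume "AE w in \<mu>. w = 0"
  then have "(\<integral>w. w\<^sup>2 \<partial>\<mu>) = (\<integral>w. 0 \<partial>\<mu>)" by (intro integral_cong_AE) auto
  then show False using int_sq by simp
qed

text \<open>If the positive part vanished, mean zero would force \<open>w = 0\<close> almost
  everywhere, against unit variance. This and \<open>prob_positive_less_1\<close> keep the gain
  constant of the tilt strictly positive.\<close>

lemma positive_part_integral_pos: "(\<integral>w. max w 0 \<partial>\<mu>) > 0"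
proof (rule ccontr)
  assume "\<not> ?thesis"
  moreover have int: "integrable \<mu> (\<lambda>w. max w 0)" using int_id by simp
  moreover have "(\<integral>w. max w 0 \<partial>\<mu>) \<ge> 0" by (intro Bochner_Integration.integral_nonneg) auto
  ultimately have "(\<integral>w. max w 0 \<partial>\<mu>) = 0" by linarith
  then have "AE w in \<mu>. max w 0 = 0" using integral_nonneg_eq_0_iff_AE[OF int] by simp
  then have "AE w in \<mu>. 0 \<le> - w" by eventually_elim auto
  then have "AE w in \<mu>. - w = 0"
    using integral_nonneg_eq_0_iff_AE[of \<mu> "\<lambda>w. - w"] int_id by simp
  then show False using not_AE_zero by simp
qed

lemma prob_positive_less_1: "(\<integral>w. indicator {0<..} w \<partial>\<mu>) < (1 :: real)"
proof (rule ccontr)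
  assume neg: "\<not> ?thesis"
  have int: "integrable \<mu> (\<lambda>w. 1 - indicator {0<..} w :: real)" by (simp add: mu.emeasure_finite less_top[symmetric])
  have "(\<integral>w. 1 - indicator {0<..} w \<partial>\<mu>) = 1 - (\<integral>w. indicator {0<..} w \<partial>\<mu> :: real)"
    by (subst Bochner_Integration.integral_diff) (simp_all add: mu.prob_space mu.emeasure_finite less_top[symmetric])
  moreover have "(\<integral>w. 1 - indicator {0<..} w \<partial>\<mu>) \<ge> (0 :: real)"
    by (intro Bochner_Integration.integral_nonneg) (auto simp: indicator_def)
  ultimately have "(\<integral>w. 1 - indicator {0<..} w \<partial>\<mu>) = (0 :: real)" using neg by linarith
  then have "AE w in \<mu>. 1 - indicator {0<..} w = (0 :: real)"
    using integral_nonneg_eq_0_iff_AE[OF int] by (simp add: indicator_def)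
  then have "AE w in \<mu>. 0 < w" by eventually_elim (auto simp: indicator_def split: if_splits)
  then have "AE w in \<mu>. 0 \<le> w" by eventually_elim auto
  then have "AE w in \<mu>. w = 0"
    using integral_nonneg_eq_0_iff_AE[of \<mu> "\<lambda>w. w"] int_id by simp
  then show False using not_AE_zero by simp
qed

end

lemma powr_add_le_add_powr:
  fixes x y \<theta> :: real
  assumes "x > 0" "y > 0" "\<theta> \<le> 1"
  shows "(x + y) powr \<theta> \<le> x powr \<theta> + y powr \<theta>"
proof -
  have *: "t \<le> t powr \<theta>" if "0 < t" "t \<le> 1" for t :: real
    using powr_mono'[of \<theta> 1 t] assms(3) that by simp
  have "1 = x / (x + y) + y / (x + y)" using assms by (simp add: add_divide_distrib[symmetric])
  also have "\<dots> \<le> (x / (x + y)) powr \<theta> + (y / (x + y)) powr \<theta>"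
    using assms by (intro add_mono *) auto
  also have "\<dots> = (x powr \<theta> + y powr \<theta>) / (x + y) powr \<theta>"
    using assms by (simp add: powr_divide add_divide_distrib)
  finally show ?thesis using assms by (simp add: field_simps)
qed

text \<open>Jensen's inequality through the tangent line at \<open>m\<close>, which at the same time
  serves as the integrable majorant.\<close>

lemma powr_moment:
  assumes M: "pos_law M" and mean: "has_bochner_integral M (\<lambda>x. x) m" and m: "m > 0"
    and th: "0 \<le> \<theta>" "\<theta> \<le> 1"
  shows "integrable M (\<lambda>x. x powr \<theta>)" and "(\<integral>x. x powr \<theta> \<partial>M) \<le> m powr \<theta>"
proof -
  note [measurable_cong] = pos_lawD(2)[OF M]
  interpret prob_space M by (rule pos_lawD(1)[OF M])
  have bnd: "has_bochner_integral M (\<lambda>x. m powr \<theta> * (\<theta> / m * x + (1 - \<theta>))) (m powr \<theta> * (\<theta> / m * m + (1 - \<theta>)))"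
    by (intro has_bochner_integral_mult_right has_bochner_integral_affine mean)
  have le: "AE x in M. x powr \<theta> \<le> m powr \<theta> * (\<theta> / m * x + (1 - \<theta>))"
    using pos_lawD(4)[OF M]
  proof eventually_elim
    case (elim x)
    have "(x / m) powr \<theta> * 1 powr (1 - \<theta>) \<le> \<theta> * (x / m) + (1 - \<theta>) * 1"
      using th elim m by (intro Youngs_inequality_0) auto
    then have "m powr \<theta> * (x / m) powr \<theta> \<le> m powr \<theta> * (\<theta> / m * x + (1 - \<theta>))"
      by (intro mult_left_mono) auto
    then show ?case using elim m by (simp add: powr_divide)
  qed
  show int: "integrable M (\<lambda>x. x powr \<theta>)"
  proof (rule Bochner_Integration.integrable_bound)
    show "integrable M (\<lambda>x. m powr \<theta> * (\<theta> / m * x + (1 - \<theta>)))"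
      using bnd by (simp only: has_bochner_integral_iff)
    show "AE x in M. norm (x powr \<theta>) \<le> norm (m powr \<theta> * (\<theta> / m * x + (1 - \<theta>)))"
      using le by eventually_elim (simp add: abs_if)
  qed measurable
  have "(\<integral>x. x powr \<theta> \<partial>M) \<le> (\<integral>x. m powr \<theta> * (\<theta> / m * x + (1 - \<theta>)) \<partial>M)"
    using int bnd le by (intro integral_mono_AE) (simp_all only: has_bochner_integral_iff)
  also have "\<dots> = m powr \<theta>" using bnd m by (simp add: has_bochner_integral_iff)
  finally show "(\<integral>x. x powr \<theta> \<partial>M) \<le> m powr \<theta>" .
qed

context pinning
begin

text \<open>The tilt \<open>1 + \<delta> f\<close>, with \<open>f = P(\<omega> > 0) - 1{\<omega> > 0}\<close>, lowers the mean of \<open>A\<close> by a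
  factor \<open>1 - c \<beta> \<delta>\<close> at a cost of order \<open>\<delta>\<^sup>2\<close> only.\<close>

lemma A_frac_dominated:
  obtains c where "c > 0"
    "\<And>p. \<exists>C\<ge>0. \<forall>\<beta> \<delta> h. 0 < \<beta> \<and> \<beta> \<le> 1 \<and> 0 \<le> \<delta> \<and> \<delta> \<le> 1 / 2 \<longrightarrow>
      frac_dominated (real p / (real p + 1)) (exp (C * \<delta>\<^sup>2)) (exp (h - c * \<beta> * \<delta>)) (A_law \<mu> \<beta> h)"
proof
  define q where "q = (\<integral>w. indicator {0<..} w \<partial>\<mu> :: real)"
  define E where "E = (\<integral>w. max w 0 \<partial>\<mu>)"
  \<comment> \<open>A bounded tilt: an exponential one lowering the mean would call for left-tail
    exponential moments, which \<open>omega_law\<close> does not supply. The denominator of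
    \<open>c\<close> bounds \<open>mgf \<mu> \<beta>\<close> for
    \<open>\<beta> \<le> 1\<close>.\<close>
  define f where "f w = q - indicator {0<..} w" for w :: real
  define c where "c = (1 - q) * E / (2 + mgf \<mu> 3)"
  have q: "0 \<le> q" "q < 1"
    using prob_positive_less_1 by (auto simp: q_def intro!: Bochner_Integration.integral_nonneg)
  have E: "E > 0" using positive_part_integral_pos by (simp add: E_def)
  have M3: "mgf \<mu> 3 \<ge> 1" by (rule mgf_ge_1) simp
  show "c > 0" using q E M3 by (simp add: c_def)
  have [measurable]: "f \<in> borel_measurable borel" unfolding f_def by measurable
  have ind: "has_bochner_integral \<mu> (\<lambda>w. indicator {0<..} w) q"
    unfolding has_bochner_integral_iff q_def by (simp add: mu.emeasure_finite less_top[symmetric])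
  have fint: "has_bochner_integral \<mu> f 0"
    using mu.has_bochner_integral_affine[OF ind, of "-1" q] by (simp add: f_def[abs_def])
  have f1: "\<bar>f w\<bar> \<le> 1" for w using q by (auto simp: f_def indicator_def)
  fix p :: nat
  define \<theta> where "\<theta> = real p / (real p + 1)"
  have th: "0 \<le> \<theta>" "\<theta> \<le> 1" by (auto simp: \<theta>_def)
  obtain C where C: "C \<ge> 0" "\<And>x::real. \<bar>x\<bar> \<le> 1 / 2 \<Longrightarrow> inverse (1 + x) ^ p \<le> 1 - real p * x + C * x\<^sup>2"
    using inverse_power_le_quadratic by blast
  have "frac_dominated \<theta> (exp (C * \<delta>\<^sup>2)) (exp (h - c * \<beta> * \<delta>)) (A_law \<mu> \<beta> h)"
    if beta: "0 < \<beta>" "\<beta> \<le> 1" and del: "0 \<le> \<delta>" "\<delta> \<le> 1 / 2" for \<beta> \<delta> h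
  proof -
    let ?X = "\<lambda>w. exp (\<beta> * w - ln (mgf \<mu> \<beta>) + h)"
    let ?g = "\<lambda>w. 1 + \<delta> * f w"
    have df: "\<bar>\<delta> * f w\<bar> \<le> 1 / 2" for w
      using mult_mono[of \<delta> "1 / 2" "\<bar>f w\<bar>" 1] f1[of w] del by (simp add: abs_mult)
    have g: "?g w \<ge> 1 / 2" for w using df[of w] by linarith
    then have g0: "?g w > 0" for w using less_le_trans[of 0 "1 / 2" "?g w"] by simp
    have gint: "has_bochner_integral \<mu> ?g 1"
      using mu.has_bochner_integral_affine[OF fint, of \<delta> 1] by (simp add: add.commute)
    have Mb: "1 \<le> mgf \<mu> \<beta>" "mgf \<mu> \<beta> \<le> 2 + mgf \<mu> 3"
    proof -
      show "1 \<le> mgf \<mu> \<beta>" by (rule mgf_ge_1[OF beta(1)])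
      have "\<beta>\<^sup>2 * (1 + mgf \<mu> 3) \<le> 1 * (1 + mgf \<mu> 3)" using beta M3 by (intro mult_right_mono power_le_one) auto
      then show "mgf \<mu> \<beta> \<le> 2 + mgf \<mu> 3" using mgf_le[of \<beta>] beta by simp
    qed
    have fe_int: "integrable \<mu> (\<lambda>w. f w * exp (\<beta> * w))"
      by (rule Bochner_Integration.integrable_bound[OF int_exp[OF beta(1)]])
         (use f1 in \<open>auto simp: abs_mult intro: mult_left_le_one_le\<close>)
    define F where "F = (\<integral>w. f w * exp (\<beta> * w) \<partial>\<mu>)"
    \<comment> \<open>Pointwise: for \<open>w > 0\<close>, where \<open>f\<close> is negative, use
      \<open>exp (\<beta> * w) \<ge> 1 + \<beta> * w\<close>; otherwise \<open>f = q\<close> and the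
      exponential is at most 1. Centring of \<open>f\<close> removes the zeroth order.\<close>
    have F: "F \<le> - (1 - q) * \<beta> * E"
    proof -
      have rhs: "has_bochner_integral \<mu> (\<lambda>w. f w + (- (1 - q) * \<beta>) * max w 0) (0 + (- (1 - q) * \<beta>) * E)"
        using int_id by (intro has_bochner_integral_add fint has_bochner_integral_mult_right) (simp add: has_bochner_integral_iff E_def)
      have "F \<le> (\<integral>w. f w + (- (1 - q) * \<beta>) * max w 0 \<partial>\<mu>)"
        unfolding F_def
      proof (rule integral_mono[OF fe_int])
        show "integrable \<mu> (\<lambda>w. f w + (- (1 - q) * \<beta>) * max w 0)" using rhs by (simp only: has_bochner_integral_iff)
        fix w :: real
        show "f w * exp (\<beta> * w) \<le> f w + (- (1 - q) * \<beta>) * max w 0"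
        proof (cases "w > 0")
          case True
          have "(1 - q) * (1 + \<beta> * w) \<le> (1 - q) * exp (\<beta> * w)"
            using q by (intro mult_left_mono) auto
          then show ?thesis using True by (simp add: f_def algebra_simps)
        next
          case False
          then have "exp (\<beta> * w) \<le> 1" using beta by (simp add: mult_nonneg_nonpos)
          then have "q * exp (\<beta> * w) \<le> q * 1" using q by (intro mult_left_mono) auto
          then show ?thesis using False by (simp add: f_def max_def)
        qed
      qed
      then show ?thesis using rhs by (simp add: has_bochner_integral_iff)
    qed
    define m where "m = (mgf \<mu> \<beta> + \<delta> * F) * (exp h / mgf \<mu> \<beta>)"
    have gX: "has_bochner_integral \<mu> (\<lambda>w. ?g w * ?X w) m"
    proof -
      have "has_bochner_integral \<mu> (\<lambda>w. (exp (\<beta> * w) + \<delta> * (f w * exp (\<beta> * w))) * (exp h / mgf \<mu> \<beta>)) m"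
        unfolding m_def
        by (intro has_bochner_integral_mult_left has_bochner_integral_add has_bochner_integral_mult_right)
           (use int_exp[OF beta(1)] fe_int in \<open>simp_all add: has_bochner_integral_iff mgf_def F_def\<close>)
      moreover have "(exp (\<beta> * w) + \<delta> * (f w * exp (\<beta> * w))) * (exp h / mgf \<mu> \<beta>) = ?g w * ?X w" for w
        using Mb(1) by (simp add: exp_add exp_diff algebra_simps add_divide_distrib)
      ultimately show ?thesis by simp
    qed
    have m_le: "m \<le> exp (h - c * \<beta> * \<delta>)"
    proof -
      have "c * \<beta> * mgf \<mu> \<beta> \<le> (1 - q) * E * \<beta>"
      proof -
        have "c * mgf \<mu> \<beta> \<le> c * (2 + mgf \<mu> 3)" using \<open>c > 0\<close> Mb by (intro mult_left_mono) auto
        also have "\<dots> = (1 - q) * E" using M3 by (simp add: c_def)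
        finally have "c * mgf \<mu> \<beta> * \<beta> \<le> (1 - q) * E * \<beta>" using beta by (intro mult_right_mono) auto
        then show ?thesis by (simp add: mult_ac)
      qed
      moreover have "- (1 - q) * \<beta> * E = - ((1 - q) * E * \<beta>)" by (simp add: algebra_simps)
      ultimately have "F \<le> - (c * \<beta> * mgf \<mu> \<beta>)" using F by linarith
      then have "\<delta> * F \<le> \<delta> * - (c * \<beta> * mgf \<mu> \<beta>)" using del by (intro mult_left_mono) auto
      then have "m \<le> (mgf \<mu> \<beta> * (1 - c * \<beta> * \<delta>)) * (exp h / mgf \<mu> \<beta>)"
        unfolding m_def using Mb(1) by (intro mult_right_mono) (auto simp: algebra_simps)
      also have "\<dots> = exp h * (1 - c * \<beta> * \<delta>)" using Mb(1) by simp
      also have "\<dots> \<le> exp h * exp (- (c * \<beta> * \<delta>))"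
        using exp_ge_add_one_self[of "- (c * \<beta> * \<delta>)"] by (intro mult_left_mono) auto
      finally show ?thesis by (simp add: exp_diff exp_minus divide_inverse)
    qed
    have m_pos: "m > 0"
    proof -
      have "- F \<le> (\<integral>w. exp (\<beta> * w) \<partial>\<mu>)"
        unfolding F_def Bochner_Integration.integral_minus[symmetric]
      proof (intro integral_mono)
        fix w :: real
        show "- (f w * exp (\<beta> * w)) \<le> exp (\<beta> * w)" 
          using f1[of w] mult_right_mono[of "- f w" 1 "exp (\<beta> * w)"] by simp
      qed (use fe_int int_exp[OF beta(1)] in auto)
      then have "\<delta> * - F \<le> \<delta> * mgf \<mu> \<beta>" using del by (intro mult_left_mono) (auto simp: mgf_def)
      moreover have "\<delta> * mgf \<mu> \<beta> \<le> 1 / 2 * mgf \<mu> \<beta>" using del Mb by (intro mult_right_mono) auto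
      moreover have "\<delta> * - F = - (\<delta> * F)" by simp
      ultimately have "mgf \<mu> \<beta> + \<delta> * F > 0" using Mb(1) by linarith
      then show ?thesis unfolding m_def using Mb by simp
    qed
    have invb: "inverse (?g w) ^ p \<le> 2 ^ p" for w
      using g[of w] g0[of w] by (intro power_mono) (auto simp: field_simps)
    have inv_int: "integrable \<mu> (\<lambda>w. inverse (?g w) ^ p)"
      by (rule mu.integrable_const_bound[where B = "2 ^ p"])
         (use invb g0 in \<open>auto simp: abs_mult less_imp_le\<close>)
    define I where "I = (\<integral>w. inverse (?g w) ^ p \<partial>\<mu>)"
    have I0: "I \<ge> 0" unfolding I_def using g0 by (intro Bochner_Integration.integral_nonneg) (auto simp: less_imp_le)
    have I_le: "I \<le> 1 + C * \<delta>\<^sup>2"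
    proof -
      have rhs: "has_bochner_integral \<mu> (\<lambda>w. (- (real p * \<delta>)) * f w + (1 + C * \<delta>\<^sup>2)) ((- (real p * \<delta>)) * 0 + (1 + C * \<delta>\<^sup>2))"
        by (rule mu.has_bochner_integral_affine[OF fint])
      have "I \<le> (\<integral>w. (- (real p * \<delta>)) * f w + (1 + C * \<delta>\<^sup>2) \<partial>\<mu>)"
        unfolding I_def
      proof (rule integral_mono[OF inv_int])
        show "integrable \<mu> (\<lambda>w. (- (real p * \<delta>)) * f w + (1 + C * \<delta>\<^sup>2))" using rhs by (simp only: has_bochner_integral_iff)
        fix w :: real
        have "(\<delta> * f w)\<^sup>2 \<le> \<delta>\<^sup>2" using f1[of w] mult_left_mono[of "(f w)\<^sup>2" 1 "\<delta>\<^sup>2"]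
          by (simp add: power_mult_distrib abs_square_le_1)
        then have "C * (\<delta> * f w)\<^sup>2 \<le> C * \<delta>\<^sup>2" using C(1) by (intro mult_left_mono)
        then show "inverse (?g w) ^ p \<le> (- (real p * \<delta>)) * f w + (1 + C * \<delta>\<^sup>2)"
          using C(2)[OF df[of w]] by simp
      qed
      then show ?thesis using rhs by (simp add: has_bochner_integral_iff)
    qed
    have "frac_dominated \<theta> (\<theta> + (1 - \<theta>) * I) m (distr \<mu> borel ?X)"
      by (rule mu.frac_dominated_tilt[OF \<theta>_def _ _ g0 gint gX _ m_pos I0])
         (use inv_int in \<open>auto simp: has_bochner_integral_iff I_def\<close>)
    then have "frac_dominated \<theta> (exp (C * \<delta>\<^sup>2)) (exp (h - c * \<beta> * \<delta>)) (distr \<mu> borel ?X)"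
    proof (rule frac_dominated_mono)
      have "\<theta> + (1 - \<theta>) * I \<le> \<theta> + (1 - \<theta>) * (1 + C * \<delta>\<^sup>2)" using I_le th by (intro add_left_mono mult_left_mono) auto
      also have "\<dots> = 1 + (1 - \<theta>) * (C * \<delta>\<^sup>2)" by (simp add: algebra_simps)
      also have "\<dots> \<le> 1 + 1 * (C * \<delta>\<^sup>2)" using th C(1) by (intro add_left_mono mult_right_mono) auto
      also have "\<dots> \<le> exp (C * \<delta>\<^sup>2)" using exp_ge_add_one_self[of "C * \<delta>\<^sup>2"] by simp
      finally show "\<theta> + (1 - \<theta>) * I \<le> exp (C * \<delta>\<^sup>2)" .
    qed (use I0 th m_pos m_le in auto)
    then show ?thesis by (simp add: A_law_def)
  qed
  then show "\<exists>C\<ge>0. \<forall>\<beta> \<delta> h. 0 < \<beta> \<and> \<beta> \<le> 1 \<and> 0 \<le> \<delta> \<and> \<delta> \<le> 1 / 2 \<longrightarrow>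
      frac_dominated (real p / (real p + 1)) (exp (C * \<delta>\<^sup>2)) (exp (h - c * \<beta> * \<delta>)) (A_law \<mu> \<beta> h)"
    using C(1) by (intro exI[of _ C]) (simp add: \<theta>_def)
qed

text \<open>\<open>L\<close> and \<open>Z\<close> are comparison sequences for the logarithms of
  cost and tilted mean. The affine step moves the mean only, which is why \<open>b\<close> enters
  the condition on \<open>Z\<close> and not the one on \<open>L\<close>.\<close>

lemma R_frac_dominated:
  assumes beta: "\<beta> > 0" and th: "\<theta> \<ge> 0"
    and A: "\<And>k. k < n \<Longrightarrow> frac_dominated \<theta> (exp (\<sigma> k)) (exp (- \<alpha> k)) (A_law \<mu> \<beta> h)"
    and L0: "L 0 \<ge> 0" and Z0: "Z 0 \<le> 0"
    and L: "\<And>k. k < n \<Longrightarrow> real s * L k + real (s - 1) * \<sigma> k \<le> L (Suc k)"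
    and Z: "\<And>k. k < n \<Longrightarrow> (exp (- (real s * Z k + real (s - 1) * \<alpha> k)) + b - 1) / b \<le> exp (- Z (Suc k))"
  shows "k \<le> n \<Longrightarrow> frac_dominated \<theta> (exp (L k)) (exp (- Z k)) (R_law s b \<mu> \<beta> h k)"
proof (induction k)
  case 0
  show ?case using frac_dominated_mono[OF frac_dominated_return, of "exp (L 0)" "exp (- Z 0)" \<theta>] L0 Z0 th by simp
next
  case (Suc k)
  then have k: "k < n" and IH: "frac_dominated \<theta> (exp (L k)) (exp (- Z k)) (R_law s b \<mu> \<beta> h k)" by auto
  have "frac_dominated \<theta> (exp (L k) ^ s * exp (\<sigma> k) ^ (s - 1)) (exp (- Z k) ^ s * exp (- \<alpha> k) ^ (s - 1)) (P_law \<beta> h k)"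
    by (intro frac_dominated_mult_conv frac_dominated_mult_conv_pow pos_law_mult_conv_pow R_pos_law A_pos_law beta IH A k) auto
  also have "exp (L k) ^ s * exp (\<sigma> k) ^ (s - 1) = exp (real s * L k + real (s - 1) * \<sigma> k)"
    by (simp only: exp_of_nat_mult[symmetric] exp_add)
  also have "exp (- Z k) ^ s * exp (- \<alpha> k) ^ (s - 1) = exp (- (real s * Z k + real (s - 1) * \<alpha> k))"
    by (simp only: exp_of_nat_mult[symmetric] exp_add[symmetric] minus_add_distrib mult_minus_right)
  finally have "frac_dominated \<theta> (exp (real s * L k + real (s - 1) * \<sigma> k))
      ((exp (- (real s * Z k + real (s - 1) * \<alpha> k)) + b - 1) / b) (R_law s b \<mu> \<beta> h (Suc k))"
    unfolding R_Suc[OF beta]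
    by (intro frac_dominated_affine b1 pos_lawD(2)[OF P_pos_law[OF beta]])
  then show ?case
    by (rule frac_dominated_mono) (use L[OF k] Z[OF k] th b1 in \<open>auto intro!: divide_nonneg_pos add_nonneg_nonneg simp: add_diff_eq[symmetric]\<close>)
qed

text \<open>The hypothesis \<open>inv\<close> makes \<open>x0\<close> a barrier for the recursion of the \<open>\<theta>\<close>-th moment.\<close>

lemma free_energy_nonpos_criterion:
  assumes beta: "\<beta> > 0" and th: "0 < \<theta>" "\<theta> \<le> 1" and h: "h \<le> h0" and h0: "h0 \<ge> 0"
    and x0: "0 < x0" "x0 \<le> 1"
    and inv: "x0 ^ s * exp h0 ^ (s - 1) + (b - 1) powr \<theta> \<le> x0 * b powr \<theta>"
    and start: "(\<integral>x. x powr \<theta> \<partial>R_law s b \<mu> \<beta> h n) \<le> x0"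
  shows "free_energy s b \<mu> \<beta> h \<le> 0"
proof (rule free_energy_nonpos_if[OF beta])
  fix m assume "m \<ge> n"
  then have u: "(\<integral>x. x powr \<theta> \<partial>R_law s b \<mu> \<beta> h m) \<le> x0"
  proof (induction m rule: dec_induct)
    case base
    show ?case by (rule start)
  next
    case (step m)
    let ?u = "\<integral>x. x powr \<theta> \<partial>R_law s b \<mu> \<beta> h m" and ?a = "\<integral>x. x powr \<theta> \<partial>A_law \<mu> \<beta> h"
    have thn: "0 \<le> \<theta>" using th by simp
    have a0: "0 \<le> ?a" and u0: "0 \<le> ?u" by (auto intro!: Bochner_Integration.integral_nonneg)
    note M = P_pos_law[OF beta, of h m]
    interpret P: prob_space "P_law \<beta> h m" by (rule pos_lawD(1)[OF M])
    have "?a \<le> exp h powr \<theta>"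
      by (rule powr_moment(2)[OF A_pos_law A_mean _ thn th(2)]) (use beta in auto)
    also have "\<dots> \<le> exp h0 powr 1"
    proof -
      have "\<theta> * h \<le> \<theta> * h0" using h th by (intro mult_left_mono) auto
      also have "\<dots> \<le> 1 * h0" using h0 th by (intro mult_right_mono) auto
      finally show ?thesis by (simp add: powr_def)
    qed
    finally have a: "?a \<le> exp h0" by simp
    have P: "has_bochner_integral (P_law \<beta> h m) (\<lambda>x. x powr \<theta>) (?u ^ s * ?a ^ (s - 1))"
      by (rule P_integral_mult[OF beta])
         (use powr_moment(1)[OF R_pos_law[OF beta] R_mean[OF beta] annealed_pos thn th(2)]
            powr_moment(1)[OF A_pos_law[OF beta] A_mean[OF beta] exp_gt_zero thn th(2)]
          in \<open>auto simp: powr_mult has_bochner_integral_iff\<close>)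
    have P': "has_bochner_integral (P_law \<beta> h m) (\<lambda>x. 1 / b powr \<theta> * (x powr \<theta>) + (b - 1) powr \<theta> / b powr \<theta>)
        (1 / b powr \<theta> * (?u ^ s * ?a ^ (s - 1)) + (b - 1) powr \<theta> / b powr \<theta>)"
      by (rule P.has_bochner_integral_affine[OF P])
    have meas: "(\<lambda>p. (p + b - 1) / b) \<in> measurable (P_law \<beta> h m) borel"
      unfolding pos_lawD(5)[OF M] by measurable
    have int: "integrable (P_law \<beta> h m) (\<lambda>p. ((p + b - 1) / b) powr \<theta>)"
      using powr_moment(1)[OF R_pos_law[OF beta] R_mean[OF beta] annealed_pos thn th(2), of h "Suc m"]
      unfolding R_Suc[OF beta] affine_law_def by (rule integrable_distr[OF meas])
    have "(\<integral>x. x powr \<theta> \<partial>R_law s b \<mu> \<beta> h (Suc m)) = (\<integral>p. ((p + b - 1) / b) powr \<theta> \<partial>P_law \<beta> h m)"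
      unfolding R_Suc[OF beta] affine_law_def by (rule integral_distr[OF meas]) measurable
    also have "\<dots> \<le> (\<integral>x. 1 / b powr \<theta> * (x powr \<theta>) + (b - 1) powr \<theta> / b powr \<theta> \<partial>P_law \<beta> h m)"
    proof (rule integral_mono_AE[OF int])
      show "AE p in P_law \<beta> h m. ((p + b - 1) / b) powr \<theta> \<le> 1 / b powr \<theta> * (p powr \<theta>) + (b - 1) powr \<theta> / b powr \<theta>"
        using pos_lawD(4)[OF M]
      proof eventually_elim
        case (elim p)
        have "(p + (b - 1)) powr \<theta> \<le> p powr \<theta> + (b - 1) powr \<theta>"
          using elim b1 th by (intro powr_add_le_add_powr) auto
        then have "(p + (b - 1)) powr \<theta> / b powr \<theta> \<le> (p powr \<theta> + (b - 1) powr \<theta>) / b powr \<theta>"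
          by (intro divide_right_mono) auto
        then show ?case using elim b1 by (simp add: powr_divide add_divide_distrib add_diff_eq)
      qed
    qed (use P' in \<open>simp only: has_bochner_integral_iff\<close>)
    also have "\<dots> = (?u ^ s * ?a ^ (s - 1) + (b - 1) powr \<theta>) / b powr \<theta>"
      using P' by (simp only: has_bochner_integral_iff) (simp add: add_divide_distrib)
    also have "\<dots> \<le> (x0 ^ s * exp h0 ^ (s - 1) + (b - 1) powr \<theta>) / b powr \<theta>"
      using step(3) a a0 u0 x0 by (intro divide_right_mono add_right_mono mult_mono power_mono) auto
    also have "\<dots> \<le> x0" using inv b1 by (simp add: divide_le_eq)
    finally show ?case .
  qed
  note M = R_pos_law[OF beta, of h m]
  interpret prob_space "R_law s b \<mu> \<beta> h m" by (rule pos_lawD(1)[OF M])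
  have int: "integrable (R_law s b \<mu> \<beta> h m) (\<lambda>x. x powr \<theta>)"
    by (rule powr_moment(1)[OF M R_mean[OF beta] annealed_pos]) (use th in auto)
  \<comment> \<open>The bound \<open>ln y \<le> y - 1\<close> at \<open>y = x powr \<theta>\<close>
    turns a \<theta>-th moment below 1 into a nonpositive expected logarithm.\<close>
  have "(\<integral>x. ln x \<partial>R_law s b \<mu> \<beta> h m) \<le> (\<integral>x. (x powr \<theta> - 1) / \<theta> \<partial>R_law s b \<mu> \<beta> h m)"
  proof (rule integral_mono_AE)
    show "AE x in R_law s b \<mu> \<beta> h m. ln x \<le> (x powr \<theta> - 1) / \<theta>"
      using pos_lawD(4)[OF M]
    proof eventually_elim
      case (elim x)
      then have "ln (x powr \<theta>) \<le> x powr \<theta> - 1" by (intro ln_le_minus_one) auto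
      then show ?case using elim th by (simp add: ln_powr field_simps)
    qed
  qed (use int R_ln_integrable[OF beta] in auto)
  also have "\<dots> = ((\<integral>x. x powr \<theta> \<partial>R_law s b \<mu> \<beta> h m) - 1) / \<theta>"
    using int by (simp add: prob_space)
  also have "\<dots> \<le> 0" using u x0 th by (intro divide_nonpos_pos) auto
  finally show "(\<integral>x. ln x \<partial>R_law s b \<mu> \<beta> h m) \<le> 0" .
qed

end

section \<open>The marginal case: lower bound on the critical point\<close>

context marginal_pinning
begin

text \<open>The profile \<open>v (Y k / n - Q v)\<close> with \<open>v = b\<^bsup>-(n - k)\<^esup>\<close> is the linearised solution of the
  tilted recursion; the term \<open>Q v\<close> absorbs its quadratic error, which is geometrically small
  away from \<open>k = n\<close>.\<close>

lemma profile_step: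
  fixes Y v :: real
  defines "Q \<equiv> b\<^sup>2 * Y\<^sup>2 / (b - 1)"
  assumes Y: "0 \<le> Y" "b\<^sup>2 * Y \<le> 1" "2 * b\<^sup>2 * Y \<le> b - 1" and v: "0 < v" "v \<le> 1"
    and k: "k < n"
  shows "(exp (- (real s * (v * (Y * real k / real n - Q * v)) + real (s - 1) * (b\<^sup>2 * Y * v / real n))) + b - 1) / b
     \<le> exp (- (b * v * (Y * real (Suc k) / real n - Q * (b * v))))"
proof -
  define u where "u = Y * real (Suc k) / real n - Q * v"
  have n: "real n > 0" using k by simp
  have Q0: "Q \<ge> 0" using b1 by (simp add: Q_def)
  have "Q \<le> Y"
  proof -
    have "b\<^sup>2 * Y * Y \<le> (b - 1) * Y"
    proof (rule mult_right_mono)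
      have "0 \<le> b\<^sup>2 * Y" using Y by simp
      then show "b\<^sup>2 * Y \<le> b - 1" using Y(3) by linarith
    qed (rule Y)
    then show ?thesis using b1 by (simp add: Q_def power2_eq_square divide_le_eq mult_ac)
  qed
  have Qv: "0 \<le> Q * v" "Q * v \<le> Q * 1" using Q0 v by (auto intro: mult_left_mono simp del: mult_1_right)
  have "Y * (real (Suc k) / real n) \<le> Y * 1" using k Y by (intro mult_left_mono) auto
  then have u_le: "\<bar>u\<bar> \<le> Y"
  proof -
    assume "Y * (real (Suc k) / real n) \<le> Y * 1"
    then have "u \<le> Y" using Qv by (simp add: u_def)
    moreover have "Y * real (Suc k) / real n \<ge> 0" using Y by simp
    then have "- Y \<le> u" using Qv \<open>Q \<le> Y\<close> unfolding u_def by linarith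
    ultimately show ?thesis by simp
  qed
  \<comment> \<open>Because \<open>s = b\<^sup>2\<close>, one unit of the tilt term advances
    \<open>k\<close> to \<open>Suc k\<close> exactly in the linear part; the bound
    \<open>s - 1 \<ge> 1\<close> supplies that unit.\<close>
  define t where "t = b\<^sup>2 * v * u"
  have "t \<le> real s * (v * (Y * real k / real n - Q * v)) + real (s - 1) * (b\<^sup>2 * Y * v / real n)"
  proof -
    have "1 * (b\<^sup>2 * Y * v / real n) \<le> real (s - 1) * (b\<^sup>2 * Y * v / real n)"
      using s2 Y v by (intro mult_right_mono) auto
    moreover have "t = real s * (v * (Y * real k / real n - Q * v)) + b\<^sup>2 * Y * v / real n"
      using n by (simp add: t_def u_def b_sq[symmetric] field_simps)
    ultimately show ?thesis by simp
  qed
  then have "(exp (- (real s * (v * (Y * real k / real n - Q * v)) + real (s - 1) * (b\<^sup>2 * Y * v / real n))) + b - 1) / b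
      \<le> (exp (- t) + b - 1) / b"
    using b1 by (intro divide_right_mono) auto
  also have "\<dots> \<le> ((1 - t + t\<^sup>2) + b - 1) / b"
  proof -
    have "v * \<bar>u\<bar> \<le> 1 * Y" using v u_le by (intro mult_mono) auto
    then have "b\<^sup>2 * (v * \<bar>u\<bar>) \<le> b\<^sup>2 * Y" by (intro mult_left_mono) auto
    then have "\<bar>t\<bar> \<le> 1" using Y v by (simp add: t_def abs_mult mult.assoc)
    then have "exp (- t) \<le> 1 + (- t) + (- t)\<^sup>2" by (intro exp_le_quadratic) auto
    then show ?thesis using b1 by (intro divide_right_mono) auto
  qed
  also have "\<dots> = 1 + (- ((t - t\<^sup>2) / b))" using b1 by (simp add: field_simps)
  also have "\<dots> \<le> exp (- ((t - t\<^sup>2) / b))" by (rule exp_ge_add_one_self)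
  also have "\<dots> \<le> exp (- (b * v * (Y * real (Suc k) / real n - Q * (b * v))))"
  proof -
    \<comment> \<open>Origin of \<open>Q\<close>: replacing \<open>v\<close> by \<open>b * v\<close>
      in the correction releases \<open>b * v\<^sup>2 * (b - 1) * Q\<close>, which is exactly
      \<open>b * v\<^sup>2 * (b\<^sup>2 * Y\<^sup>2)\<close> and so dominates the quadratic
      error.\<close>
    have "u\<^sup>2 \<le> Y\<^sup>2" using u_le Y by (simp add: abs_le_square_iff[symmetric])
    then have "b\<^sup>2 * u\<^sup>2 \<le> (b - 1) * Q" using b1 by (simp add: Q_def)
    then have "b * v\<^sup>2 * (b\<^sup>2 * u\<^sup>2) \<le> b * v\<^sup>2 * ((b - 1) * Q)" using b1 by (intro mult_left_mono) auto
    moreover have "(t - t\<^sup>2) / b = b * v * u - b * v\<^sup>2 * (b\<^sup>2 * u\<^sup>2)"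
      using b1 by (simp add: t_def field_simps power2_eq_square)
    moreover have "b * v * (Y * real (Suc k) / real n - Q * (b * v)) = b * v * u - b * v\<^sup>2 * ((b - 1) * Q)"
      by (simp add: u_def algebra_simps power2_eq_square)
    ultimately show ?thesis by simp
  qed
  finally show ?thesis .
qed

text \<open>Taking \<open>s\<close> copies multiplies the cost by \<open>s = b\<^sup>2\<close>, just
  as the square of \<open>v\<close> grows from one level to the next. Every scale hence contributes
  at most \<open>C\<close> in final units, \<open>n * C\<close> in total, while the log mean drops
  by \<open>Y - Q \<ge> Y / 2\<close>.\<close>

lemma R_powr_moment_bound:
  assumes beta: "\<beta> > 0" and th: "0 \<le> \<theta>" "\<theta> \<le> 1"
    and Y: "0 \<le> Y" "b\<^sup>2 * Y \<le> 1" "2 * b\<^sup>2 * Y \<le> b - 1" and n: "n > 0" and C: "C \<ge> 0"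
    and A: "\<And>v. 0 < v \<Longrightarrow> v \<le> 1 \<Longrightarrow> 1 / b ^ n \<le> v \<Longrightarrow>
      frac_dominated \<theta> (exp (C * v\<^sup>2)) (exp (- (b\<^sup>2 * Y * v / real n))) (A_law \<mu> \<beta> h)"
  shows "(\<integral>x. x powr \<theta> \<partial>R_law s b \<mu> \<beta> h n) \<le> exp (real n * C - \<theta> * Y / 2)"
proof -
  define Q where "Q = b\<^sup>2 * Y\<^sup>2 / (b - 1)"
  define v where "v k = 1 / b ^ (n - k)" for k
  have v: "0 < v k" "v k \<le> 1" "1 / b ^ n \<le> v k" for k
    using b1 by (auto simp: v_def intro!: divide_left_mono power_increasing)
  have v_Suc: "v (Suc k) = b * v k" if "k < n" for k
  proof -
    have "n - k = Suc (n - Suc k)" using that by simp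
    then show ?thesis using b1 by (simp add: v_def)
  qed
  define Z where "Z k = v k * (Y * real k / real n - Q * v k)" for k
  define L where "L k = real k * C * (v k)\<^sup>2" for k
  define \<sigma> where "\<sigma> k = C * (v k)\<^sup>2" for k
  have Q0: "Q \<ge> 0" using b1 by (simp add: Q_def)
  have fd: "frac_dominated \<theta> (exp (L n)) (exp (- Z n)) (R_law s b \<mu> \<beta> h n)"
  proof (rule R_frac_dominated[where n = n and \<sigma> = \<sigma> and \<alpha> = "\<lambda>k. b\<^sup>2 * Y * v k / real n"])
    fix k assume k: "k < n"
    show "frac_dominated \<theta> (exp (\<sigma> k)) (exp (- (b\<^sup>2 * Y * v k / real n))) (A_law \<mu> \<beta> h)"
      unfolding \<sigma>_def by (rule A[OF v])
    have "(s - 1) + 1 = s" using s2 by simp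
    then have "real (s - 1) = real s - 1" using s2 by (simp add: of_nat_diff)
    then have "real s * L k + real (s - 1) * \<sigma> k = (real s * real k + real s - 1) * (C * (v k)\<^sup>2)"
      by (simp add: L_def \<sigma>_def algebra_simps)
    also have "\<dots> \<le> (real s * real (Suc k)) * (C * (v k)\<^sup>2)"
      using C by (intro mult_right_mono) (auto simp: algebra_simps)
    also have "\<dots> = L (Suc k)" using k by (simp add: L_def v_Suc power_mult_distrib b_sq)
    finally show "real s * L k + real (s - 1) * \<sigma> k \<le> L (Suc k)" .
    show "(exp (- (real s * Z k + real (s - 1) * (b\<^sup>2 * Y * v k / real n))) + b - 1) / b \<le> exp (- Z (Suc k))"
      using profile_step[OF Y v(1,2) k, of k] unfolding Z_def Q_def v_Suc[OF k] .
  next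
    show "Z 0 \<le> 0" using Q0 v(1)[of 0] by (simp add: Z_def mult_nonneg_nonneg less_imp_le)
  qed (use beta th in \<open>auto simp: L_def\<close>)
  have ZL: "Z n = Y - Q" "L n = real n * C" using n by (auto simp: Z_def L_def v_def)
  have "Q \<le> Y / 2"
  proof -
    have "2 * b\<^sup>2 * Y * Y \<le> (b - 1) * Y" using Y by (intro mult_right_mono) auto
    then show ?thesis using b1 by (simp add: Q_def power2_eq_square divide_simps mult_ac)
  qed
  then have Zn: "- Z n \<le> - Y / 2" using ZL by simp
  have int: "integrable (R_law s b \<mu> \<beta> h n) (\<lambda>x. x powr \<theta>)"
    by (rule powr_moment(1)[OF R_pos_law[OF beta] R_mean[OF beta] annealed_pos th])
  have "ennreal (\<integral>x. x powr \<theta> \<partial>R_law s b \<mu> \<beta> h n) = (\<integral>\<^sup>+x. ennreal (x powr \<theta>) \<partial>R_law s b \<mu> \<beta> h n)"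
    using int by (intro nn_integral_eq_integral[symmetric]) auto
  also have "\<dots> \<le> ennreal (exp (L n) * exp (- Z n) powr \<theta>)"
    using frac_dominatedD[OF fd, of 0 1] by simp
  finally have "(\<integral>x. x powr \<theta> \<partial>R_law s b \<mu> \<beta> h n) \<le> exp (L n) * exp (- Z n) powr \<theta>"
    by (subst (asm) ennreal_le_iff) auto
  also have "\<dots> = exp (L n + \<theta> * (- Z n))" by (simp add: powr_def flip: exp_add)
  also have "\<dots> \<le> exp (real n * C - \<theta> * Y / 2)"
    using mult_left_mono[OF Zn th(1)] ZL by simp
  finally show ?thesis .
qed

text \<open>At \<open>\<theta> = 1\<close>, \<open>h0 = 0\<close> the inequality is strict: the
  slope of \<open>x ^ s\<close> at 1 is \<open>b\<^sup>2 > b\<close>, so slightly below 1 the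
  annealed map pushes downwards. Strictness leaves room first to take \<theta> below 1 and then
  \<open>h0\<close> above 0.\<close>

lemma invariant_parameters:
  assumes y: "0 < y" "b\<^sup>2 * y \<le> 1" "b ^ 3 * y < b - 1"
  obtains p h0 where "p \<ge> 1" "h0 > 0"
    "exp (- y) ^ s * exp h0 ^ (s - 1) + (b - 1) powr (real p / (real p + 1)) \<le> exp (- y) * b powr (real p / (real p + 1))"
proof -
  have lim1: "(\<lambda>p. real p / (real p + 1)) \<longlonglongrightarrow> 1"
    using LIMSEQ_n_over_Suc_n by (simp add: add.commute)
  have "(\<lambda>p. exp (- y) * b powr (real p / (real p + 1)) - (b - 1) powr (real p / (real p + 1)))
      \<longlonglongrightarrow> exp (- y) * b powr 1 - (b - 1) powr 1"
    using b1 by (intro tendsto_intros lim1) auto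
  moreover have "exp (- y) ^ s < exp (- y) * b powr 1 - (b - 1) powr 1"
  proof -
    have "exp (- y) ^ s = exp (- (b\<^sup>2 * y))" by (simp add: b_sq flip: exp_of_nat_mult)
    also have "\<dots> \<le> 1 + (- (b\<^sup>2 * y)) + (- (b\<^sup>2 * y))\<^sup>2" 
    proof (rule exp_le_quadratic)
      have "0 \<le> b\<^sup>2 * y" using y by simp
      then show "- (b\<^sup>2 * y) \<le> 1" by linarith
    qed
    also have "\<dots> < b * (1 - y) - (b - 1)"
    proof -
      have "(b * y) * (b ^ 3 * y) < (b * y) * (b - 1)" using y b1 by (intro mult_strict_left_mono) auto
      then show ?thesis by (simp add: algebra_simps power2_eq_square power3_eq_cube)
    qed
    also have "\<dots> \<le> b * exp (- y) - (b - 1)"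
      using exp_ge_add_one_self[of "- y"] b1 by (intro diff_right_mono mult_left_mono) auto
    finally show ?thesis using b1 by (simp add: mult.commute)
  qed
  ultimately have "\<forall>\<^sub>F p in sequentially. exp (- y) ^ s < exp (- y) * b powr (real p / (real p + 1)) - (b - 1) powr (real p / (real p + 1))"
    by (rule order_tendstoD(1))
  then obtain p where p: "p \<ge> 1" "exp (- y) ^ s < exp (- y) * b powr (real p / (real p + 1)) - (b - 1) powr (real p / (real p + 1))"
    unfolding eventually_sequentially by (metis max.cobounded1 max.cobounded2)
  define r where "r = exp (- y) * b powr (real p / (real p + 1)) - (b - 1) powr (real p / (real p + 1))"
  define h0 where "h0 = ln (r / exp (- y) ^ s) / real (s - 1)"
  have r: "r / exp (- y) ^ s > 1" using p(2) by (simp add: r_def)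
  have "h0 > 0" unfolding h0_def using r s2 by (intro divide_pos_pos ln_gt_zero) auto
  moreover have "exp (- y) ^ s * exp h0 ^ (s - 1) + (b - 1) powr (real p / (real p + 1)) \<le> exp (- y) * b powr (real p / (real p + 1))"
  proof -
    have "exp h0 ^ (s - 1) = exp (real (s - 1) * h0)" by (simp add: exp_of_nat_mult)
    also have "real (s - 1) * h0 = ln (r / exp (- y) ^ s)" using s2 by (simp add: h0_def)
    also have "exp (ln (r / exp (- y) ^ s)) = r / exp (- y) ^ s" using less_trans[OF zero_less_one r] by (rule exp_ln)
    finally show ?thesis by (simp add: r_def)
  qed
  ultimately show ?thesis using that p(1) by blast
qed

lemma free_energy_nonpos_exp:
  "\<exists>c1>0. \<forall>\<beta> h. 0 < \<beta> \<and> \<beta> \<le> 1 \<and> h \<le> exp (- c1 / \<beta>\<^sup>2) \<longrightarrow> free_energy s b \<mu> \<beta> h \<le> 0"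
proof -
  obtain c where c: "c > 0"
    "\<And>p. \<exists>C\<ge>0. \<forall>\<beta> \<delta> h. 0 < \<beta> \<and> \<beta> \<le> 1 \<and> 0 \<le> \<delta> \<and> \<delta> \<le> 1 / 2 \<longrightarrow>
      frac_dominated (real p / (real p + 1)) (exp (C * \<delta>\<^sup>2)) (exp (h - c * \<beta> * \<delta>)) (A_law \<mu> \<beta> h)"
    using A_frac_dominated by blast
  \<comment> \<open>Small enough for \<open>profile_step\<close> and, as \<open>Y / 8\<close>, for
    \<open>invariant_parameters\<close>. The order of choice matters: \<open>Y\<close> fixes
    \<open>p\<close>, which fixes the cost constant \<open>C\<close>, which fixes
    \<open>N\<close>.\<close>
  define Y where "Y = (b - 1) / (2 * b ^ 3)"
  have Y: "Y > 0" using b1 by (simp add: Y_def)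
  have Y3: "b ^ 3 * Y = (b - 1) / 2" using b1 by (simp add: Y_def)
  have Y2: "b\<^sup>2 * Y = (b - 1) / (2 * b)" using b1 by (simp add: Y_def power2_eq_square power3_eq_cube)
  have Ya: "b\<^sup>2 * Y \<le> 1" unfolding Y2 using b1 by (simp add: divide_le_eq)
  have Yb: "2 * b\<^sup>2 * Y \<le> b - 1"
  proof -
    have "2 * b\<^sup>2 * Y = (b - 1) / b" using Y2 b1 by simp
    also have "\<dots> \<le> (b - 1) / 1" using b1 by (intro divide_left_mono) auto
    finally show ?thesis by simp
  qed
  obtain p h0 where p: "p \<ge> 1" and h0: "h0 > 0"
    and inv: "exp (- (Y / 8)) ^ s * exp h0 ^ (s - 1) + (b - 1) powr (real p / (real p + 1)) \<le> exp (- (Y / 8)) * b powr (real p / (real p + 1))"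
  proof (rule invariant_parameters[of "Y / 8"])
    show "b\<^sup>2 * (Y / 8) \<le> 1" using Ya by simp
    show "b ^ 3 * (Y / 8) < b - 1" using Y3 b1 by simp
  qed (use Y in auto)
  define \<theta> where "\<theta> = real p / (real p + 1)"
  have th: "1 / 2 \<le> \<theta>" "\<theta> \<le> 1" using p by (auto simp: \<theta>_def field_simps)
  obtain C where C: "C \<ge> 0"
    "\<And>\<beta> \<delta> h. 0 < \<beta> \<Longrightarrow> \<beta> \<le> 1 \<Longrightarrow> 0 \<le> \<delta> \<Longrightarrow> \<delta> \<le> 1 / 2 \<Longrightarrow>
      frac_dominated \<theta> (exp (C * \<delta>\<^sup>2)) (exp (h - c * \<beta> * \<delta>)) (A_law \<mu> \<beta> h)"
    using c(2)[of p] unfolding \<theta>_def by blast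
  \<comment> \<open>The tilt will be \<open>\<delta> = G * v / (\<beta> * n)\<close>, so that
    \<open>c * \<beta> * \<delta>\<close> is twice the drift wanted: one half offsets
    \<open>h\<close>, the other remains.\<close>
  define G where "G = 2 * b\<^sup>2 * Y / c"
  have G: "G > 0" using b1 Y c(1) by (simp add: G_def)
  \<comment> \<open>With \<open>n * \<beta>\<^sup>2 \<ge> N\<close>, the first summand ensures
    \<open>\<delta> \<le> 1 / 2\<close> and the second a total cost of at most
    \<open>Y / 8\<close>.\<close>
  define N where "N = 2 * G + 8 * C * G\<^sup>2 / Y + 1"
  have CG: "8 * C * G\<^sup>2 / Y \<ge> 0" using C(1) Y by simp
  have N: "N \<ge> 1" "N \<ge> 2 * G" "N \<ge> 8 * C * G\<^sup>2 / Y" unfolding N_def using G CG by linarith+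
  \<comment> \<open>\<open>h\<close> must lie below the smallest drift
    \<open>b\<^sup>2 * Y / (n * b ^ n)\<close>, and
    \<open>n * b ^ n \<le> exp (n * (1 + ln b))\<close> with
    \<open>n \<le> (N + 1) / \<beta>\<^sup>2\<close>. The absolute values absorb the prefactor and
    ensure \<open>h \<le> h0\<close>.\<close>
  define c1 where "c1 = (N + 1) * (1 + ln b) + \<bar>ln (b\<^sup>2 * Y)\<bar> + \<bar>ln h0\<bar>"
  have lnb: "ln b > 0" using b1 by simp
  have c1: "c1 > 0" unfolding c1_def using N lnb by (intro add_pos_nonneg mult_pos_pos) auto
  have "free_energy s b \<mu> \<beta> h \<le> 0" if beta: "0 < \<beta>" "\<beta> \<le> 1" and h: "h \<le> exp (- c1 / \<beta>\<^sup>2)" for \<beta> h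
  proof -
    have b2: "0 < \<beta>\<^sup>2" "\<beta>\<^sup>2 \<le> 1" using beta by (auto intro: power_le_one)
    define n where "n = nat \<lceil>N / \<beta>\<^sup>2\<rceil>"
    have Nb: "N / \<beta>\<^sup>2 \<ge> 1" using N b2 by (simp add: le_divide_eq)
    have n_ge: "N / \<beta>\<^sup>2 \<le> real n" unfolding n_def by (rule real_nat_ceiling_ge)
    have n_le: "real n \<le> (N + 1) / \<beta>\<^sup>2"
    proof -
      have "real n \<le> N / \<beta>\<^sup>2 + 1" unfolding n_def using Nb by linarith
      also have "1 \<le> 1 / \<beta>\<^sup>2" using b2 by simp
      finally show ?thesis by (simp add: add_divide_distrib)
    qed
    have n0: "real n > 0" using n_ge Nb by linarith
    have nb2: "N \<le> real n * \<beta>\<^sup>2" using n_ge b2 by (simp add: divide_le_eq)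
    have h_h0: "h \<le> h0"
    proof -
      have "\<bar>ln h0\<bar> \<le> c1" unfolding c1_def using N lnb by simp
      also have "c1 \<le> c1 / \<beta>\<^sup>2" using c1 b2 by (simp add: le_divide_eq mult_left_le)
      finally have "- c1 / \<beta>\<^sup>2 \<le> ln h0" by simp
      then have "exp (- c1 / \<beta>\<^sup>2) \<le> exp (ln h0)" by simp
      then show ?thesis using h h0 by simp
    qed
    have h_small: "h \<le> b\<^sup>2 * Y / real n * (1 / b ^ n)"
    proof -
      have "real n * b ^ n \<le> exp (real n) * exp (real n * ln b)"
      proof (rule mult_mono)
        show "real n \<le> exp (real n)" using exp_ge_add_one_self[of "real n"] by linarith
        show "b ^ n \<le> exp (real n * ln b)" using b1 by (simp add: exp_of_nat_mult)
      qed (use b1 in auto)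
      also have "\<dots> = exp (real n * (1 + ln b))" by (simp add: distrib_left exp_add)
      also have "\<dots> \<le> exp ((N + 1) / \<beta>\<^sup>2 * (1 + ln b))" 
      proof -
        have "real n * (1 + ln b) \<le> (N + 1) / \<beta>\<^sup>2 * (1 + ln b)" using n_le lnb by (intro mult_right_mono) auto
        then show ?thesis by (simp only: exp_le_cancel_iff)
      qed
      finally have nbn: "real n * b ^ n \<le> exp ((N + 1) / \<beta>\<^sup>2 * (1 + ln b))" .
      define g where "g = \<bar>ln (b\<^sup>2 * Y)\<bar>"
      have g: "g \<le> g / \<beta>\<^sup>2" using b2 by (simp add: g_def le_divide_eq mult_left_le)
      have "exp (- c1 / \<beta>\<^sup>2) * (real n * b ^ n) \<le> exp (- c1 / \<beta>\<^sup>2) * exp ((N + 1) / \<beta>\<^sup>2 * (1 + ln b))"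
        using nbn by (intro mult_left_mono) auto
      also have "\<dots> = exp (- c1 / \<beta>\<^sup>2 + (N + 1) / \<beta>\<^sup>2 * (1 + ln b))" by (rule exp_add[symmetric])
      also have "- c1 / \<beta>\<^sup>2 + (N + 1) / \<beta>\<^sup>2 * (1 + ln b) = - (g / \<beta>\<^sup>2) - \<bar>ln h0\<bar> / \<beta>\<^sup>2"
        unfolding c1_def g_def using beta by (simp add: field_simps)
      also have "exp \<dots> \<le> exp (ln (b\<^sup>2 * Y))"
      proof -
        have "\<bar>ln h0\<bar> / \<beta>\<^sup>2 \<ge> 0" by simp
        moreover have "- g \<le> ln (b\<^sup>2 * Y)" unfolding g_def by linarith
        ultimately show ?thesis using g unfolding exp_le_cancel_iff by linarith
      qed
      also have "\<dots> = b\<^sup>2 * Y" using Y b1 by simp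
      finally have "exp (- c1 / \<beta>\<^sup>2) \<le> b\<^sup>2 * Y / (real n * b ^ n)" using n0 b1 by (simp add: le_divide_eq)
      then show ?thesis using h by simp
    qed
    have mom: "(\<integral>x. x powr \<theta> \<partial>R_law s b \<mu> \<beta> h n) \<le> exp (real n * (C * (G / (\<beta> * real n))\<^sup>2) - \<theta> * Y / 2)"
    proof (rule R_powr_moment_bound)
      fix v :: real assume v: "0 < v" "v \<le> 1" "1 / b ^ n \<le> v"
      define \<delta> where "\<delta> = G / (\<beta> * real n) * v"
      have d0: "\<delta> \<ge> 0" using G beta n0 v by (simp add: \<delta>_def)
      have d1: "\<delta> \<le> 1 / 2"
      proof -
        have "\<beta>\<^sup>2 \<le> \<beta> * 1" unfolding power2_eq_square using beta by (intro mult_left_mono) auto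
        then have "\<beta>\<^sup>2 * real n \<le> \<beta> * real n" using n0 by (intro mult_right_mono) auto
        then have "2 * G \<le> \<beta> * real n" using N(2) nb2 by (simp add: mult.commute)
        then have "G / (\<beta> * real n) \<le> 1 / 2" using beta n0 by (simp add: divide_le_eq)
        then have "G / (\<beta> * real n) * v \<le> 1 / 2 * 1" using v by (intro mult_mono) auto
        then show ?thesis by (simp add: \<delta>_def)
      qed
      have "h - c * \<beta> * \<delta> \<le> - (b\<^sup>2 * Y * v / real n)"
      proof -
        have "b\<^sup>2 * Y / real n * (1 / b ^ n) \<le> b\<^sup>2 * Y / real n * v"
          using v Y n0 by (intro mult_left_mono) auto
        then have "h \<le> b\<^sup>2 * Y * v / real n" using h_small by simp
        moreover have "c * \<beta> * \<delta> = 2 * (b\<^sup>2 * Y * v / real n)"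
          using c(1) beta n0 by (simp add: \<delta>_def G_def)
        moreover have "x - d \<le> - w" if "x \<le> w" "d = 2 * w" for x d w :: real using that by simp
        ultimately show ?thesis by blast
      qed
      then have "frac_dominated \<theta> (exp (C * \<delta>\<^sup>2)) (exp (- (b\<^sup>2 * Y * v / real n))) (A_law \<mu> \<beta> h)"
        by (intro frac_dominated_mono[OF C(2)[OF beta d0 d1]]) (use th in auto)
      then show "frac_dominated \<theta> (exp (C * (G / (\<beta> * real n))\<^sup>2 * v\<^sup>2)) (exp (- (b\<^sup>2 * Y * v / real n))) (A_law \<mu> \<beta> h)"
        by (simp only: \<delta>_def power_mult_distrib mult.assoc)
    qed (use beta th Y Ya Yb n0 C(1) in auto)
    have "real n * (C * (G / (\<beta> * real n))\<^sup>2) = C * G\<^sup>2 / (real n * \<beta>\<^sup>2)"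
      using n0 beta by (simp add: power2_eq_square)
    also have "\<dots> \<le> C * G\<^sup>2 / N"
      using nb2 N C(1) by (intro divide_left_mono) auto
    also have "\<dots> \<le> Y / 8" using N Y by (simp add: divide_le_eq mult_ac)
    finally have "real n * (C * (G / (\<beta> * real n))\<^sup>2) \<le> Y / 8" .
    \<comment> \<open>As \<open>\<theta> \<ge> 1 / 2\<close>, the gain is at least
      \<open>Y / 4\<close>; minus the cost \<open>Y / 8\<close> this leaves the barrier
      \<open>exp (- (Y / 8))\<close> for which \<open>p\<close> and \<open>h0\<close> were
      selected.\<close>
    moreover have "\<theta> * Y / 2 \<ge> Y / 4" using mult_right_mono[OF th(1), of Y] Y by simp
    ultimately have "exp (real n * (C * (G / (\<beta> * real n))\<^sup>2) - \<theta> * Y / 2) \<le> exp (- (Y / 8))"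
      unfolding exp_le_cancel_iff by linarith
    then have start: "(\<integral>x. x powr \<theta> \<partial>R_law s b \<mu> \<beta> h n) \<le> exp (- (Y / 8))" using mom by linarith
    show ?thesis
      by (rule free_energy_nonpos_criterion[OF beta(1) _ th(2) h_h0 _ _ _ inv[folded \<theta>_def] start])
         (use th h0 Y in auto)
  qed
  then show ?thesis using c1 by blast
qed

end

theorem theorem1p5:
  fixes s :: nat and \<mu> :: "real measure"
  assumes "s \<ge> 2" and "omega_law \<mu>"
  shows "\<exists>c1 c2 \<beta>0. c1 > 0 \<and> c2 > 0 \<and> \<beta>0 > 0 \<and>
           (\<forall>\<beta>. 0 < \<beta> \<and> \<beta> \<le> \<beta>0 \<longrightarrow>
              exp (- c1 / \<beta>\<^sup>2) \<le> h_crit s (sqrt (real s)) \<mu> \<beta> \<and>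
              h_crit s (sqrt (real s)) \<mu> \<beta> \<le> exp (- c2 / \<beta>))"
proof -
  interpret marginal_pinning s "sqrt (real s)" \<mu>
    by unfold_locales (use assms in auto)
  obtain c1 where c1: "c1 > 0"
    "\<And>\<beta> h. 0 < \<beta> \<Longrightarrow> \<beta> \<le> 1 \<Longrightarrow> h \<le> exp (- c1 / \<beta>\<^sup>2) \<Longrightarrow> free_energy s (sqrt (real s)) \<mu> \<beta> h \<le> 0"
    using free_energy_nonpos_exp by blast
  obtain c2 \<beta>0 where c2: "c2 > 0" "\<beta>0 > 0"
    "\<And>\<beta>. 0 < \<beta> \<Longrightarrow> \<beta> \<le> \<beta>0 \<Longrightarrow> free_energy s (sqrt (real s)) \<mu> \<beta> (exp (- c2 / \<beta>)) > 0"
    using free_energy_pos_exp by blast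
  have "exp (- c1 / \<beta>\<^sup>2) \<le> h_crit s (sqrt (real s)) \<mu> \<beta> \<and> h_crit s (sqrt (real s)) \<mu> \<beta> \<le> exp (- c2 / \<beta>)"
    if beta: "0 < \<beta>" "\<beta> \<le> min \<beta>0 1" for \<beta>
  proof -
    let ?H = "{h. free_energy s (sqrt (real s)) \<mu> \<beta> h > 0}"
    \<comment> \<open>A real \<open>Inf\<close> is informative only for a nonempty set bounded
      below: the upper-bound argument gives a member, the lower-bound argument the bound.\<close>
    have mem: "exp (- c2 / \<beta>) \<in> ?H" using c2(3) beta by simp
    have lb: "exp (- c1 / \<beta>\<^sup>2) \<le> h" if "h \<in> ?H" for h
      using c1(2)[of \<beta> h] beta that by (cases "h \<le> exp (- c1 / \<beta>\<^sup>2)") auto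
    have "exp (- c1 / \<beta>\<^sup>2) \<le> Inf ?H" using mem lb by (intro cInf_greatest) auto
    moreover have "Inf ?H \<le> exp (- c2 / \<beta>)" using mem lb by (intro cInf_lower bdd_belowI) auto
    ultimately show ?thesis by (simp add: h_crit_def)
  qed
  then show ?thesis using c1(1) c2(1,2) by (intro exI[of _ c1] exI[of _ c2] exI[of _ "min \<beta>0 1"]) auto
qed

end
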